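(* Let $G$ be a group and let $A$ be a central subgroup of $G$ such that $A\subseteq G'=[G,G]$. Let $\rho_\ast(A\otimes_{\mathbb{Z}} H_2(G,\mathbb{Z}))\subseteq H_3(G,\mathbb{Z})$ denote the image of $A\otimes_{\mathbb{Z}} H_2(G,\mathbb{Z})$ under the homomorphism induced by the product map $\rho: A\times G\to G$, $(a,g)\mapsto ag$. Then the image of the natural map $$H_3(A,\mathbb{Z})\to H_3(G,\mathbb{Z})/\rho_\ast(A\otimes_{\mathbb{Z}} H_2(G,\mathbb{Z}))$$ induced by the inclusion $A\hookrightarrow G$ is $2$-torsion.
   Context: $H_n(-,\mathbb{Z})$ denotes integral group homology. The subgroup $\rho_\ast(A\otimes_{\mathbb{Z}} H_2(G,\mathbb{Z}))$ is the image of the composite $A\otimes_{\mathbb{Z}} H_2(G,\mathbb{Z})= H_1(A,\mathbb{Z})\otimes_{\mathbb{Z}} H_2(G,\mathbb{Z})\to H_3(A\times G,\mathbb{Z})\xrightarrow{\rho_\ast} H_3(G,\mathbb{Z})$, where the first map is the homology cross product and $\rho$ is a group homomorphism because $A$ is central. An abelian group is called $2$-torsion if each of its elements $x$ satisfies $2x=0$. *)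

theory Defs
  imports "HOL-Algebra.Free_Abelian_Groups" "HOL-Algebra.Generated_Groups"
begin

section \<open>Integral group homology\<close>

text \<open>
  \<open>H\<^sub>n(G,\<int>)\<close> is the homology of the (unnormalised, inhomogeneous) bar complex with trivial
  coefficients: the \<open>n\<close>-chains are the formal integer combinations of symbols
  \<open>[g\<^sub>1|\<dots>|g\<^sub>n]\<close>, represented as lists of length \<open>n\<close> over the carrier, and the boundary is
  \<open>[g\<^sub>2|\<dots>|g\<^sub>n] + (\<Sum>0<i<n. (-1)\<^sup>i [g\<^sub>1|\<dots>|g\<^sub>i g\<^sub>i\<^sub>+\<^sub>1|\<dots>|g\<^sub>n]) + (-1)\<^sup>n [g\<^sub>1|\<dots>|g\<^sub>n\<^sub>-\<^sub>1]\<close>.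
  All homology groups are written multiplicatively, following \<open>HOL-Algebra\<close>.
\<close>

type_synonym 'a bar_chain = "'a list \<Rightarrow>\<^sub>0 int"

definition bar_simplices :: "nat \<Rightarrow> ('a, 'm) monoid_scheme \<Rightarrow> 'a list set" where
  "bar_simplices n G = {xs. length xs = n \<and> set xs \<subseteq> carrier G}"

definition bar_chain_group :: "nat \<Rightarrow> ('a, 'm) monoid_scheme \<Rightarrow> 'a bar_chain monoid" where
  "bar_chain_group n G = free_Abelian_group (bar_simplices n G)"

definition bar_face :: "('a, 'm) monoid_scheme \<Rightarrow> nat \<Rightarrow> 'a list \<Rightarrow> 'a list" where
  "bar_face G i xs =
     (if i = 0 then tl xs
      else if i = length xs then butlast xs
      else take (i - 1) xs @ (xs ! (i - 1) \<otimes>\<^bsub>G\<^esub> xs ! i) # drop (i + 1) xs)"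

definition bar_boundary :: "('a, 'm) monoid_scheme \<Rightarrow> 'a bar_chain \<Rightarrow> 'a bar_chain" where
  "bar_boundary G = frag_extend (\<lambda>xs. if xs = [] then 0
     else \<Sum>i\<le>length xs. frag_cmul ((-1) ^ i) (frag_of (bar_face G i xs)))"

definition bar_cycles :: "nat \<Rightarrow> ('a, 'm) monoid_scheme \<Rightarrow> 'a bar_chain set" where
  "bar_cycles n G = {c \<in> carrier (bar_chain_group n G). bar_boundary G c = 0}"

definition bar_boundaries :: "nat \<Rightarrow> ('a, 'm) monoid_scheme \<Rightarrow> 'a bar_chain set" where
  "bar_boundaries n G = bar_boundary G ` carrier (bar_chain_group (Suc n) G)"

definition bar_cycle_group :: "nat \<Rightarrow> ('a, 'm) monoid_scheme \<Rightarrow> 'a bar_chain monoid" where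
  "bar_cycle_group n G = (bar_chain_group n G)\<lparr>carrier := bar_cycles n G\<rparr>"

definition group_homology :: "nat \<Rightarrow> ('a, 'm) monoid_scheme \<Rightarrow> 'a bar_chain set monoid" where
  "group_homology n G = bar_cycle_group n G Mod bar_boundaries n G"

definition homology_class :: "nat \<Rightarrow> ('a, 'm) monoid_scheme \<Rightarrow> 'a bar_chain \<Rightarrow> 'a bar_chain set" where
  "homology_class n G c = bar_boundaries n G #>\<^bsub>bar_cycle_group n G\<^esub> c"

definition bar_map :: "('a \<Rightarrow> 'b) \<Rightarrow> 'a bar_chain \<Rightarrow> 'b bar_chain" where
  "bar_map f = frag_extend (\<lambda>xs. frag_of (map f xs))"

text \<open>
  Homology classes are cosets of cycles. A map on homology induced by a map on cycles is written as
  the union over all representatives; when the class of the result does not depend on the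
  representative, as for chain maps, all members of the union coincide.
\<close>

definition group_homology_map ::
  "nat \<Rightarrow> ('a, 'm) monoid_scheme \<Rightarrow> ('b, 'n) monoid_scheme \<Rightarrow> ('a \<Rightarrow> 'b)
    \<Rightarrow> 'a bar_chain set \<Rightarrow> 'b bar_chain set" where
  "group_homology_map n G H f X =
     (\<Union>c \<in> X \<inter> bar_cycles n G. homology_class n H (bar_map f c))"

section \<open>The homology cross product\<close>

text \<open>
  On the bar complex the cross product is the Eilenberg--Zilber shuffle map
  \<open>[g\<^sub>1|\<dots>|g\<^sub>p] \<times> [h\<^sub>1|\<dots>|h\<^sub>q] = \<Sum>\<^sub>\<sigma> sgn(\<sigma>) \<sigma>[(g\<^sub>1,1)|\<dots>|(g\<^sub>p,1)|(1,h\<^sub>1)|\<dots>|(1,h\<^sub>q)]\<close>, the sum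
  ranging over the \<open>(p,q)\<close>-shuffles. In the recursion, putting \<open>(1,h\<^sub>1)\<close> first moves it past
  all the remaining \<open>g\<close>s, which accounts for the sign.
\<close>

fun bar_shuffle ::
  "('a, 'm) monoid_scheme \<Rightarrow> ('b, 'n) monoid_scheme \<Rightarrow> 'a list \<Rightarrow> 'b list \<Rightarrow> ('a \<times> 'b) bar_chain"
where
  "bar_shuffle G H [] ys = frag_of (map (\<lambda>y. (\<one>\<^bsub>G\<^esub>, y)) ys)"
| "bar_shuffle G H (x # xs) [] = frag_of (map (\<lambda>x. (x, \<one>\<^bsub>H\<^esub>)) (x # xs))"
| "bar_shuffle G H (x # xs) (y # ys) =
     frag_extend (\<lambda>zs. frag_of ((x, \<one>\<^bsub>H\<^esub>) # zs)) (bar_shuffle G H xs (y # ys))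
     + frag_cmul ((-1) ^ length (x # xs))
         (frag_extend (\<lambda>zs. frag_of ((\<one>\<^bsub>G\<^esub>, y) # zs)) (bar_shuffle G H (x # xs) ys))"

definition bar_cross ::
  "('a, 'm) monoid_scheme \<Rightarrow> ('b, 'n) monoid_scheme \<Rightarrow> 'a bar_chain \<Rightarrow> 'b bar_chain
    \<Rightarrow> ('a \<times> 'b) bar_chain" where
  "bar_cross G H c d = frag_extend (\<lambda>xs. frag_extend (\<lambda>ys. bar_shuffle G H xs ys) d) c"

definition homology_cross ::
  "nat \<Rightarrow> nat \<Rightarrow> ('a, 'm) monoid_scheme \<Rightarrow> ('b, 'n) monoid_scheme
    \<Rightarrow> 'a bar_chain set \<Rightarrow> 'b bar_chain set \<Rightarrow> ('a \<times> 'b) bar_chain set" where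
  "homology_cross p q G H X Y =
     (\<Union>c \<in> X \<inter> bar_cycles p G. \<Union>d \<in> Y \<inter> bar_cycles q H.
        homology_class (p + q) (G \<times>\<times> H) (bar_cross G H c d))"

section \<open>Tensor products of abelian groups\<close>

definition tensor_relations ::
  "('a, 'm) monoid_scheme \<Rightarrow> ('b, 'n) monoid_scheme \<Rightarrow> ('a \<times> 'b \<Rightarrow>\<^sub>0 int) set" where
  "tensor_relations M N =
     {frag_of (m \<otimes>\<^bsub>M\<^esub> m', n) - frag_of (m, n) - frag_of (m', n) | m m' n.
        m \<in> carrier M \<and> m' \<in> carrier M \<and> n \<in> carrier N}
     \<union> {frag_of (m, n \<otimes>\<^bsub>N\<^esub> n') - frag_of (m, n) - frag_of (m, n') | m n n'.
        m \<in> carrier M \<and> n \<in> carrier N \<and> n' \<in> carrier N}"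

definition tensor_product ::
  "('a, 'm) monoid_scheme \<Rightarrow> ('b, 'n) monoid_scheme \<Rightarrow> ('a \<times> 'b \<Rightarrow>\<^sub>0 int) set monoid" where
  "tensor_product M N =
     (let F = free_Abelian_group (carrier M \<times> carrier N)
      in F Mod generate F (tensor_relations M N))"

definition free_Abelian_lift ::
  "('c, 'p) monoid_scheme \<Rightarrow> ('k \<Rightarrow> 'c) \<Rightarrow> ('k \<Rightarrow>\<^sub>0 int) \<Rightarrow> 'c" where
  "free_Abelian_lift P f u =
     finprod P (\<lambda>k. f k [^]\<^bsub>P\<^esub> Poly_Mapping.lookup u k) (Poly_Mapping.keys u)"

text \<open>
  The homomorphism on the tensor product induced by a bilinear map \<open>\<beta>\<close>; for bilinear \<open>\<beta>\<close> the
  lift to the free abelian group is constant on each coset.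
\<close>

definition tensor_lift ::
  "('c, 'p) monoid_scheme \<Rightarrow> ('a \<Rightarrow> 'b \<Rightarrow> 'c) \<Rightarrow> ('a \<times> 'b \<Rightarrow>\<^sub>0 int) set \<Rightarrow> 'c" where
  "tensor_lift P \<beta> X = the_elem (free_Abelian_lift P (case_prod \<beta>) ` X)"

section \<open>Central subgroups and the maps of the theorem\<close>

definition central_subgroup :: "'a set \<Rightarrow> ('a, 'm) monoid_scheme \<Rightarrow> bool" where
  "central_subgroup A G \<longleftrightarrow>
     subgroup A G \<and> (\<forall>a \<in> A. \<forall>g \<in> carrier G. a \<otimes>\<^bsub>G\<^esub> g = g \<otimes>\<^bsub>G\<^esub> a)"

text \<open>
  The map \<open>A \<otimes> H\<^sub>2(G,\<int>) \<rightarrow> H\<^sub>3(A \<times> G,\<int>)\<close>, where \<open>A\<close> is identified with \<open>H\<^sub>1(A,\<int>)\<close> by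
  sending \<open>a\<close> to the class of \<open>[a]\<close>.
\<close>

definition tensor_cross_map ::
  "('a, 'm) monoid_scheme \<Rightarrow> 'a set \<Rightarrow> ('a \<times> 'a bar_chain set \<Rightarrow>\<^sub>0 int) set
    \<Rightarrow> ('a \<times> 'a) bar_chain set" where
  "tensor_cross_map G A =
     tensor_lift (group_homology 3 (G\<lparr>carrier := A\<rparr> \<times>\<times> G))
       (\<lambda>a z. homology_cross 1 2 (G\<lparr>carrier := A\<rparr>) G
                (homology_class 1 (G\<lparr>carrier := A\<rparr>) (frag_of [a])) z)"

definition rho_image :: "('a, 'm) monoid_scheme \<Rightarrow> 'a set \<Rightarrow> 'a bar_chain set set" where
  "rho_image G A =
     group_homology_map 3 (G\<lparr>carrier := A\<rparr> \<times>\<times> G) G (\<lambda>(a, g). a \<otimes>\<^bsub>G\<^esub> g)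
       ` tensor_cross_map G A ` carrier (tensor_product (G\<lparr>carrier := A\<rparr>) (group_homology 2 G))"

definition rho_quotient :: "('a, 'm) monoid_scheme \<Rightarrow> 'a set \<Rightarrow> 'a bar_chain set set monoid" where
  "rho_quotient G A = group_homology 3 G Mod rho_image G A"

definition natural_map ::
  "('a, 'm) monoid_scheme \<Rightarrow> 'a set \<Rightarrow> 'a bar_chain set \<Rightarrow> 'a bar_chain set set" where
  "natural_map G A X =
     rho_image G A #>\<^bsub>group_homology 3 G\<^esub> group_homology_map 3 (G\<lparr>carrier := A\<rparr>) G (\<lambda>a. a) X"

definition two_torsion :: "('a, 'm) monoid_scheme \<Rightarrow> bool" where
  "two_torsion K \<longleftrightarrow> comm_group K \<and> (\<forall>x \<in> carrier K. x [^]\<^bsub>K\<^esub> (2::nat) = \<one>\<^bsub>K\<^esub>)"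

end

theory Submission
  imports Defs
begin

text \<open>
  Write \<open>[a] \<cdot> w\<close> for the push-forward along \<open>\<rho>\<close> of the cross product of \<open>[a]\<close>, \<open>a \<in> A\<close>, with a chain \<open>w\<close>
  of \<open>G\<close>; more generally \<open>c \<cdot> w\<close> for chains \<open>c\<close> of \<open>A\<close>. These products
  obey the Leibniz rule, and the subgroup to be divided out contains the classes of all \<open>[a] \<cdot> w\<close> with
  \<open>w\<close> a 2-cycle of \<open>G\<close>.

  The proof rests on two facts about a 3-cycle \<open>z\<close> of \<open>A\<close>.

  First, \<open>z\<close> is homologous to a sum \<open>\<Sum> [x] \<cdot> [b|c]\<close> with \<open>x, b, c \<in> A\<close>, where the individual \<open>[b|c]\<close> need
  not be cycles (\<open>cycle_decomposable\<close>). Modulo boundaries and such products, the symbol \<open>[x|y|z]\<close>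
  is the associator of a symmetric monoidal groupoid with objects \<open>A\<close> whose braiding is the identity.
  Such an associator is the coboundary of a 2-cochain \<open>k\<close>: behind this is the vanishing of \<open>Ext\<^sup>2\<close>
  over the integers, and the cochain is built by adjoining one generator of \<open>A\<close> after the other
  (\<open>strict_symmetric_cocycle_cobounds\<close>). A cycle \<open>z\<close> is therefore congruent to \<open>k (\<partial>z) = 0\<close>.

  Second, since \<open>A\<close> lies in the derived subgroup, \<open>[x] = \<partial>(s x)\<close> for some 2-chain \<open>s x\<close> of \<open>G\<close>
  (\<open>derived_bounds\<close>). Now \<open>[x] \<cdot> [b|c] = [b|c] \<cdot> \<partial>(s x)\<close>, which by the Leibniz rule is
  \<open>- \<partial>[b|c] \<cdot> s x\<close> up to a boundary. The sum \<open>z\<close> being a cycle means exactly that the tensor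
  \<open>\<Sum> x \<otimes> \<partial>[b|c]\<close> is symmetric, so the two entries may be exchanged and
  \<open>z\<close> is homologous to \<open>- \<Sum> [x] \<cdot> s(\<partial>[b|c])\<close>. Adding the two expressions for \<open>z\<close> gives
  \<open>2z \<sim> \<Sum> [x] \<cdot> ([b|c] - s(\<partial>[b|c]))\<close>, and here each second factor is a 2-cycle of \<open>G\<close>
  (\<open>double_decomposable\<close>).
\<close>

section \<open>Congruences modulo a subgroup\<close>

locale congruence_subgroup =
  fixes N :: "'u::ab_group_add set"
  assumes zero_mem: "0 \<in> N"
    and diff_mem: "\<And>x y. x \<in> N \<Longrightarrow> y \<in> N \<Longrightarrow> x - y \<in> N"
begin

definition cong :: "'u \<Rightarrow> 'u \<Rightarrow> bool" (infix "\<simeq>" 50) where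
  "x \<simeq> y \<longleftrightarrow> x - y \<in> N"

lemma uminus_mem: "x \<in> N \<Longrightarrow> - x \<in> N"
  using diff_mem[OF zero_mem] by simp

lemma add_mem: "x \<in> N \<Longrightarrow> y \<in> N \<Longrightarrow> x + y \<in> N"
  using diff_mem[OF _ uminus_mem] by fastforce

lemma cong_refl [simp, intro]: "x \<simeq> x"
  by (simp add: cong_def zero_mem)

lemma cong_sym: "x \<simeq> y \<Longrightarrow> y \<simeq> x"
  unfolding cong_def using uminus_mem by fastforce

lemma cong_trans [trans]: "x \<simeq> y \<Longrightarrow> y \<simeq> z \<Longrightarrow> x \<simeq> z"
  unfolding cong_def using add_mem[of "x - y" "y - z"] by simp

lemma cong_add: "x \<simeq> y \<Longrightarrow> x' \<simeq> y' \<Longrightarrow> x + x' \<simeq> y + y'"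
  unfolding cong_def using add_mem[of "x - y" "x' - y'"] by (simp add: algebra_simps)

lemma cong_diff: "x \<simeq> y \<Longrightarrow> x' \<simeq> y' \<Longrightarrow> x - x' \<simeq> y - y'"
  unfolding cong_def using diff_mem[of "x - y" "x' - y'"] by (simp add: algebra_simps)

lemma cong_uminus: "x \<simeq> y \<Longrightarrow> - x \<simeq> - y"
  using cong_diff[OF cong_refl, of x y 0] by simp

lemma cong_sum: "(\<And>i. i \<in> I \<Longrightarrow> f i \<simeq> g i) \<Longrightarrow> sum f I \<simeq> sum g I"
  by (induction I rule: infinite_finite_induct) (auto intro: cong_add)

text \<open>
  A congruence is proved by exhibiting it as a linear combination of known ones; the remaining
  goal is an identity in an abelian group.
\<close>

lemma cong_by: "x' \<simeq> y' \<Longrightarrow> x - y = x' - y' \<Longrightarrow> x \<simeq> y"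
  unfolding cong_def by simp

end

text \<open>
  The sum of \<open>f\<close> over \<open>0, \<dots>, n - 1\<close>, continued to negative \<open>n\<close> as the solution of the difference
  equation \<open>int_sum_Suc\<close>.
\<close>

definition int_sum :: "(int \<Rightarrow> 'u::ab_group_add) \<Rightarrow> int \<Rightarrow> 'u" where
  "int_sum f n = sum f {0..<n} - sum f {n..<0}"

lemma int_sum_0 [simp]: "int_sum f 0 = 0"
  by (simp add: int_sum_def)

lemma int_sum_Suc: "int_sum f (n + 1) = int_sum f n + f n"
proof (cases "n \<ge> 0")
  case True
  then have "{0..<n + 1} = insert n {0..<n}" by auto
  with True show ?thesis by (simp add: int_sum_def add.commute)
next
  case False
  then have "{n..<0} = insert n {n + 1..<0}" by auto
  with False show ?thesis by (simp add: int_sum_def)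
qed

lemma (in congruence_subgroup) int_sum_cong:
  "(\<And>m. f m \<simeq> g m) \<Longrightarrow> int_sum f n \<simeq> int_sum g n"
  unfolding int_sum_def by (intro cong_diff cong_sum)

lemma int_sum_diff: "int_sum (\<lambda>m. f m - g m) n = int_sum f n - int_sum g n"
  by (simp add: int_sum_def sum_subtractf)

lemma int_step_induct:
  assumes "P 0" "\<And>n::int. P n \<longleftrightarrow> P (n + 1)"
  shows "P n"
proof (induction n rule: int_induct[where k = 0])
  case (step2 i)
  then show ?case using assms(2)[of "i - 1"] by simp
qed (use assms in auto)

lemma int_sum_telescope: "int_sum (\<lambda>m. f (m + 1) - f m) n = f n - f 0"
  by (rule int_step_induct[of "\<lambda>n. int_sum (\<lambda>m. f (m + 1) - f m) n = f n - f 0"])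
     (auto simp: int_sum_Suc algebra_simps)

lemma (in congruence_subgroup) periodic_cong:
  fixes f :: "('i \<Rightarrow>\<^sub>0 int) \<Rightarrow> 'u"
  assumes "\<And>x. f (x + r) \<simeq> f x"
  shows "f (x + frag_cmul n r) \<simeq> f x"
proof (rule int_step_induct[of "\<lambda>n. f (x + frag_cmul n r) \<simeq> f x"])
  fix n
  have "x + frag_cmul (n + 1) r = (x + frag_cmul n r) + r"
    by (simp add: frag_cmul_distrib add.assoc)
  then have "f (x + frag_cmul (n + 1) r) \<simeq> f (x + frag_cmul n r)"
    using assms[of "x + frag_cmul n r"] by (simp only:)
  then show "f (x + frag_cmul n r) \<simeq> f x \<longleftrightarrow> f (x + frag_cmul (n + 1) r) \<simeq> f x"
    using cong_trans cong_sym by blast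
qed auto

section \<open>Symmetric 3-cocycles with trivial braiding are coboundaries\<close>

definition cobound2 :: "('g::plus \<Rightarrow> 'g \<Rightarrow> 'u::ab_group_add) \<Rightarrow> 'g \<Rightarrow> 'g \<Rightarrow> 'g \<Rightarrow> 'u" where
  "cobound2 k x y z = k y z - k (x + y) z + k x (y + z) - k x y"

text \<open>
  The two axioms are the pentagon for an associator \<open>\<psi>\<close> and the hexagon for \<open>\<psi>\<close> with the identity as
  braiding, in the abelian group of values modulo \<open>N\<close>. The cocycle lives on a free abelian group;
  a cocycle on an arbitrary abelian group is pulled back along a presentation, and the relations
  of the presentation reappear below as periods of the cocycle.
\<close>

locale strict_symmetric_cocycle = congruence_subgroup N
  for N :: "'u::ab_group_add set" +
  fixes \<psi> :: "('i \<Rightarrow>\<^sub>0 int) \<Rightarrow> ('i \<Rightarrow>\<^sub>0 int) \<Rightarrow> ('i \<Rightarrow>\<^sub>0 int) \<Rightarrow> 'u"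
  assumes cocycle: "\<psi> y z w - \<psi> (x + y) z w + \<psi> x (y + z) w - \<psi> x y (z + w) + \<psi> x y z \<simeq> 0"
    and hexagon: "\<psi> x y z - \<psi> y x z + \<psi> y z x \<simeq> 0"
begin

lemma reversal: "\<psi> x y z \<simeq> - \<psi> z y x"
  by (rule cong_by[OF cong_add[OF hexagon[of x y z] hexagon[of z y x]]]) simp

lemma palindrome: "\<psi> x y x \<simeq> 0"
  using hexagon[of x y x] by simp

lemma zero_left: "\<psi> 0 y z \<simeq> \<psi> 0 0 (y + z) - \<psi> 0 0 y"
  by (rule cong_by[OF cocycle[of 0 y z 0]]) simp

lemma zero_right: "\<psi> x y 0 \<simeq> \<psi> 0 0 y - \<psi> 0 0 (x + y)"
  by (rule cong_by[OF cong_diff[OF reversal[of x y 0] zero_left[of y x]]])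
     (simp add: algebra_simps)

lemma zero_middle: "\<psi> x 0 z \<simeq> \<psi> 0 0 z - \<psi> 0 0 x"
  by (rule cong_by[OF cong_diff[OF reversal[of x 0 0] cocycle[of 0 0 z x]]])
     (simp add: algebra_simps)

text \<open>
  The pentagon for \<open>t, y, z, t\<close> with all terms turned around by \<open>reversal\<close>. This symmetry in \<open>y\<close> and \<open>z\<close>
  is what makes the cochain \<open>K0\<close> below symmetric.
\<close>

lemma double_reversal: "\<psi> t y (z + t) - \<psi> t y z \<simeq> \<psi> t z (y + t) - \<psi> t z y"
proof -
  have "\<psi> y z t - \<psi> (t + y) z t + \<psi> t (y + z) t - \<psi> t y (z + t) + \<psi> t y z \<simeq> 0"
    by (rule cocycle)
  note h = this palindrome[of t "y + z"] reversal[of y z t] reversal[of "t + y" z t]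
  show ?thesis
    by (rule cong_by[OF cong_diff[OF cong_add[OF cong_diff[OF h(3) h(4)] h(2)] h(1)]])
       (simp add: algebra_simps)
qed

end

text \<open>
  One step of the induction over the coordinates of the free abelian group. The subgroup \<open>R\<close> consists of
  periods of \<open>\<psi>\<close>, and \<open>k\<close> solves the problem for the cocycle in which the coordinate \<open>a\<close> of each
  argument is replaced by zero.
\<close>

locale coordinate_step = strict_symmetric_cocycle N \<psi>
  for N :: "'u::ab_group_add set" and \<psi> :: "('i \<Rightarrow>\<^sub>0 int) \<Rightarrow> ('i \<Rightarrow>\<^sub>0 int) \<Rightarrow> ('i \<Rightarrow>\<^sub>0 int) \<Rightarrow> 'u" +
  fixes a :: 'i and R :: "('i \<Rightarrow>\<^sub>0 int) set" and k :: "('i \<Rightarrow>\<^sub>0 int) \<Rightarrow> ('i \<Rightarrow>\<^sub>0 int) \<Rightarrow> 'u"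
  assumes R_zero: "0 \<in> R" and R_diff: "\<And>r s. r \<in> R \<Longrightarrow> s \<in> R \<Longrightarrow> r - s \<in> R"
    and period1: "\<And>r x y z. r \<in> R \<Longrightarrow> \<psi> (x + r) y z = \<psi> x y z"
    and period2: "\<And>r x y z. r \<in> R \<Longrightarrow> \<psi> x (y + r) z = \<psi> x y z"
    and period3: "\<And>r x y z. r \<in> R \<Longrightarrow> \<psi> x y (z + r) = \<psi> x y z"
    and k_sym: "\<And>x y. k x y \<simeq> k y x"
    and k_cobound: "\<And>x y z. cobound2 k x y z
      \<simeq> \<psi> (x - frag_cmul (Poly_Mapping.lookup x a) (frag_of a)) (y - frag_cmul (Poly_Mapping.lookup y a) (frag_of a))
          (z - frag_cmul (Poly_Mapping.lookup z a) (frag_of a))"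
    and k_period: "\<And>r x y. r - frag_cmul (Poly_Mapping.lookup r a) (frag_of a) \<in> R \<Longrightarrow> k (x + r) y \<simeq> k x y"
begin

abbreviation t where "t \<equiv> frag_of a"
abbreviation ix where "ix x \<equiv> Poly_Mapping.lookup x a"
definition pr where "pr x = x - frag_cmul (ix x) t"

lemma pr_add: "pr (x + y) = pr x + pr y"
  by (simp add: pr_def lookup_add frag_cmul_distrib)

lemma pr_t [simp]: "pr t = 0"
  by (simp add: pr_def)

lemma pr_0 [simp]: "pr 0 = 0"
  by (simp add: pr_def)

lemma ix_pr [simp]: "ix (pr x) = 0"
  by (simp add: pr_def lookup_minus)

lemma pr_pr [simp]: "pr (pr x) = pr x"
  by (simp add: pr_def lookup_minus)

lemma pr_decomp: "x = pr x + frag_cmul (ix x) t"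
  by (simp add: pr_def)

lemma ix_add_t [simp]: "ix (x + t) = ix x + 1"
  by (simp add: lookup_add)

lemma t_periodic: "(\<And>x. f (x + t) \<simeq> f x) \<Longrightarrow> f x \<simeq> f (pr x)"
  using periodic_cong[of f t "pr x" "ix x"] by (simp flip: pr_decomp)

lemma k_cobound': "cobound2 k x y z \<simeq> \<psi> (pr x) (pr y) (pr z)"
  using k_cobound by (simp add: pr_def)

lemma k_period': "pr r \<in> R \<Longrightarrow> k (x + r) y \<simeq> k x y"
  using k_period by (simp add: pr_def)

lemma k_t: "k (x + t) y \<simeq> k x y"
  by (rule k_period') (simp add: R_zero)

lemma k_zero_left: "k 0 y \<simeq> \<psi> 0 0 (pr y) + k 0 0"
  by (rule cong_by[OF k_cobound'[of 0 0 y]]) (simp add: cobound2_def)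

text \<open>
  The extension of \<open>k\<close> that is forced by two normalisations: \<open>K0 t y\<close> and \<open>K0 y t\<close> do not depend on \<open>y\<close>.
  With them \<open>cobound2 K0 t x y = \<psi> t x y\<close> and \<open>cobound2 K0 y x t = \<psi> y x t\<close> become recursions for \<open>K0\<close>
  in the coordinate \<open>a\<close> of the first and of the second argument, and the two sums solve them.
\<close>

definition K0 where
  "K0 x y = k x y + int_sum (\<lambda>m. \<psi> (pr x) (pr y + frag_cmul m t) t) (ix y)
     - int_sum (\<lambda>m. \<psi> t (pr x + frag_cmul m t) y) (ix x)"

lemma K0_pr: "K0 (pr x) (pr y) = k (pr x) (pr y)"
  by (simp add: K0_def)

lemma K0_add_t_left: "K0 (x + t) y \<simeq> K0 x y - \<psi> t x y"
  by (rule cong_by[OF k_t[of x y]])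
     (simp add: K0_def pr_add int_sum_Suc flip: pr_decomp)

lemma k_t_right: "k y (x + t) \<simeq> k y x"
  by (rule cong_trans[OF k_sym cong_trans[OF k_t k_sym]])

text \<open>
  The second sum in \<open>K0 y x\<close> depends on \<open>x\<close> as well. By \<open>double_reversal\<close> its increments form a telescoping
  sum, whose boundary terms turn the increment \<open>\<psi> (pr y) x t\<close> of the first sum into \<open>\<psi> y x t\<close>.
\<close>

lemma K0_add_t_right: "K0 y (x + t) \<simeq> K0 y x + \<psi> y x t"
proof -
  have "int_sum (\<lambda>m. \<psi> t (pr y + frag_cmul m t) (x + t) - \<psi> t (pr y + frag_cmul m t) x) (ix y)
      \<simeq> int_sum (\<lambda>m. \<psi> t x (pr y + frag_cmul (m + 1) t) - \<psi> t x (pr y + frag_cmul m t)) (ix y)"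
  proof (rule int_sum_cong)
    fix m
    show "\<psi> t (pr y + frag_cmul m t) (x + t) - \<psi> t (pr y + frag_cmul m t) x
        \<simeq> \<psi> t x (pr y + frag_cmul (m + 1) t) - \<psi> t x (pr y + frag_cmul m t)"
      using double_reversal[of t "pr y + frag_cmul m t" x]
      by (simp add: frag_cmul_distrib add.assoc)
  qed
  also have "\<dots> = \<psi> t x y - \<psi> t x (pr y)"
    by (subst int_sum_telescope) (simp flip: pr_decomp)
  finally have s: "int_sum (\<lambda>m. \<psi> t (pr y + frag_cmul m t) (x + t)) (ix y)
      - int_sum (\<lambda>m. \<psi> t (pr y + frag_cmul m t) x) (ix y) \<simeq> \<psi> t x y - \<psi> t x (pr y)"
    by (simp only: int_sum_diff)
  show ?thesis
    by (rule cong_by[OF cong_diff[OF cong_add[OF k_t_right[of y x]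
            cong_diff[OF reversal[of "pr y" x t] reversal[of y x t]]] s]])
       (simp add: K0_def pr_add int_sum_Suc flip: pr_decomp)
qed

text \<open>
  By the two recursions and \<open>reversal\<close> the antisymmetric part of \<open>K0\<close> is periodic in both arguments,
  and on arguments with coordinate \<open>a\<close> zero \<open>K0\<close> is \<open>k\<close>.
\<close>

lemma K0_sym: "K0 x y \<simeq> K0 y x"
proof -
  define e where "e x y = K0 x y - K0 y x" for x y
  have e_t: "e (x + t) y \<simeq> e x y" for x y
    by (rule cong_by[OF cong_diff[OF cong_diff[OF K0_add_t_left[of x y] K0_add_t_right[of y x]]
            reversal[of t x y]]]) (simp add: e_def)
  have "e x y \<simeq> e (pr x) y"
    by (rule t_periodic) (rule e_t)
  also have "\<dots> = - e y (pr x)"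
    by (simp add: e_def)
  also have "\<dots> \<simeq> - e (pr y) (pr x)"
    by (rule cong_uminus, rule t_periodic) (rule e_t)
  also have "\<dots> = k (pr x) (pr y) - k (pr y) (pr x)"
    by (simp add: e_def K0_pr)
  finally show ?thesis
    by (rule cong_by[OF cong_add[OF _ k_sym[of "pr x" "pr y"]]]) (simp add: e_def)
qed

lemma K0_t: "K0 t y \<simeq> k 0 0 + \<psi> 0 0 t"
proof -
  have "K0 t (y + t) \<simeq> K0 t y" for y
    by (rule cong_by[OF cong_add[OF K0_add_t_right[of t y] palindrome[of t y]]]) simp
  then have "K0 t y \<simeq> K0 t (pr y)"
    by (rule t_periodic)
  also have "\<dots> \<simeq> K0 0 (pr y) - \<psi> t 0 (pr y)"
    using K0_add_t_left[of 0 "pr y"] by simp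
  also have "\<dots> = k 0 (pr y) - \<psi> t 0 (pr y)"
    using K0_pr[of 0 y] by simp
  also have "\<dots> \<simeq> \<psi> 0 0 (pr y) + k 0 0 - (\<psi> 0 0 (pr y) - \<psi> 0 0 t)"
    using k_zero_left[of "pr y"] zero_middle[of t "pr y"] by (intro cong_diff) simp_all
  finally show ?thesis by simp
qed

text \<open>
  The defect \<open>D\<close> of \<open>K0\<close> is again a strictly symmetric cocycle, and it vanishes as soon as one
  argument is \<open>t\<close>. The pentagon then makes it periodic in each argument, so it can be evaluated where
  all coordinates \<open>a\<close> are zero, and there \<open>K0\<close> is \<open>k\<close>.
\<close>

lemma K0_cobound: "cobound2 K0 x y z \<simeq> \<psi> x y z"
proof -
  define D where "D x y z = cobound2 K0 x y z - \<psi> x y z" for x y z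
  have D_cocycle: "D y z w - D (x + y) z w + D x (y + z) w - D x y (z + w) + D x y z \<simeq> 0"
    for x y z w
    by (rule cong_by[OF cong_uminus[OF cocycle[of y z w x]]])
       (simp add: D_def cobound2_def algebra_simps)
  have D_hexagon: "D x y z - D y x z + D y z x \<simeq> 0" for x y z
    by (rule cong_by[OF cong_diff[OF cong_diff[OF
              cong_diff[OF K0_sym[of y x] K0_sym[of "y + z" x]] K0_sym[of x z]]
              hexagon[of x y z]]]) (simp add: D_def cobound2_def algebra_simps)
  interpret D: strict_symmetric_cocycle N D
    by unfold_locales (rule D_cocycle D_hexagon)+
  have D_t_left: "D t y z \<simeq> 0" for y z
    by (rule cong_by[OF cong_add[OF cong_diff[OF K0_t[of "y + z"] K0_t[of y]]
            cong_uminus[OF K0_add_t_left[of y z]]]])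
       (simp add: D_def cobound2_def algebra_simps)
  have D_t_right: "D x y t \<simeq> 0" for x y
    by (rule cong_by[OF cong_diff[OF D.reversal[of x y t] D_t_left[of y x]]]) simp
  have D_t_middle: "D x t z \<simeq> 0" for x z
    by (rule cong_by[OF cong_diff[OF cong_add[OF D_t_left[of x z] D_t_right[of x z]]
          D.hexagon[of t x z]]]) simp
  have left: "D (x + t) y z \<simeq> D x y z" for x y z
    by (rule cong_by[OF cong_add[OF cong_diff[OF D_t_left[of "x + y" z] D_t_left[of x "y + z"]]
          cong_diff[OF D_t_left[of x y] D.cocycle[of x y z t]]]]) (simp add: algebra_simps)
  have right: "D x y (z + t) \<simeq> D x y z" for x y z
    by (rule cong_by[OF cong_add[OF cong_diff[OF D.reversal[of x y "z + t"] D.reversal[of x y z]]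
          cong_uminus[OF left[of z y x]]]]) (simp add: algebra_simps)
  have middle: "D x (y + t) z \<simeq> D x y z" for x y z
    by (rule cong_by[OF cong_add[OF cong_diff[OF
            D.hexagon[of x "y + t" z] D.hexagon[of x y z]]
           cong_add[OF left[of y x z] cong_uminus[OF left[of y z x]]]]]) (simp add: algebra_simps)
  have "D x y z \<simeq> D (pr x) y z"
    by (rule t_periodic) (rule left)
  also have "\<dots> \<simeq> D (pr x) (pr y) z"
    by (rule t_periodic) (rule middle)
  also have "\<dots> \<simeq> D (pr x) (pr y) (pr z)"
    by (rule t_periodic) (rule right)
  also have "\<dots> = cobound2 k (pr x) (pr y) (pr z) - \<psi> (pr x) (pr y) (pr z)"
    by (simp add: D_def cobound2_def K0_pr flip: pr_add)
  also have "\<dots> \<simeq> 0"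
    by (rule cong_by[OF k_cobound'[of "pr x" "pr y" "pr z"]]) simp
  finally show ?thesis
    by (rule cong_by) (simp add: D_def)
qed

lemma K0_period: "r \<in> R \<Longrightarrow> ix r = 0 \<Longrightarrow> K0 (x + r) y \<simeq> K0 x y"
proof -
  assume r: "r \<in> R" "ix r = 0"
  then have pr: "pr r = r" by (simp add: pr_def)
  have 1: "\<psi> (pr x + r) y' z = \<psi> (pr x) y' z" for y' z
    by (rule period1[OF r(1)])
  have 2: "\<psi> t (pr x + r + frag_cmul m t) y = \<psi> t (pr x + frag_cmul m t) y" for m
    using period2[OF r(1), of t "pr x + frag_cmul m t" y] by (simp add: ac_simps)
  have "K0 (x + r) y - K0 x y = k (x + r) y - k x y"
    by (simp add: K0_def pr_add pr lookup_add r 1 2)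
  then show ?thesis
    using k_period'[of r x y] r by (simp add: pr cong_def)
qed

lemma frag_cmul_R: "r \<in> R \<Longrightarrow> frag_cmul n r \<in> R"
  by (rule frag_closure_minus_cmul) (use R_diff R_zero in auto)

text \<open>
  It remains to make \<open>K0\<close> invariant under the periods \<open>r\<close> that involve the coordinate \<open>a\<close>, if there are
  any. Up to periods with coordinate zero they are the multiples of a single \<open>r0\<close>, with \<open>ix r0 = n\<close> minimal
  positive. Changing \<open>K0\<close> by the coboundary of a 1-cochain \<open>u\<close> achieves \<open>K x r0 = \<psi> 0 0 x + u r0\<close>, where
  \<open>u r0\<close> is a constant, and this value, inserted into \<open>cobound2 K x y r0 = \<psi> x y 0\<close>, says that \<open>K\<close> is
  \<open>r0\<close>-periodic. The equation to be solved by \<open>u\<close> is the difference equation \<open>u_r0\<close>; it is solvable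
  because \<open>r0\<close> has infinite order.
\<close>

lemma extension:
  "\<exists>K. (\<forall>x y. K x y \<simeq> K y x) \<and> (\<forall>x y z. cobound2 K x y z \<simeq> \<psi> x y z)
     \<and> (\<forall>r\<in>R. \<forall>x y. K (x + r) y \<simeq> K x y)"
proof (cases "\<exists>r\<in>R. ix r \<noteq> 0")
  case False
  with K0_sym K0_cobound K0_period show ?thesis by blast
next
  case True
  then obtain r where r: "r \<in> R" "ix r \<noteq> 0" by blast
  define Q where "Q n \<longleftrightarrow> 0 < n \<and> (\<exists>r\<in>R. ix r = int n)" for n
  have "\<exists>n. Q n"
  proof (cases "ix r > 0")
    case True
    with r show ?thesis unfolding Q_def by (intro exI[of _ "nat (ix r)"]) auto
  next
    case False
    with r R_diff[OF R_zero r(1)] show ?thesis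
      unfolding Q_def by (intro exI[of _ "nat (- ix r)"]) (auto simp: lookup_minus intro!: bexI[of _ "- r"])
  qed
  then have "Q (LEAST n. Q n)" by (rule LeastI_ex)
  then obtain n where n: "Q n" and n_min: "\<And>m. Q m \<Longrightarrow> n \<le> m"
    using Least_le by blast
  then obtain r0 where n_pos: "0 < n" and r0: "r0 \<in> R" "ix r0 = int n"
    unfolding Q_def by blast
  have R_split: "\<exists>q s. s \<in> R \<and> ix s = 0 \<and> r = s + frag_cmul q r0" if "r \<in> R" for r
  proof -
    define s where "s = r - frag_cmul (ix r div int n) r0"
    have s: "s \<in> R" unfolding s_def using that r0 by (intro R_diff frag_cmul_R)
    have ixs: "ix s = ix r mod int n"
      by (simp add: s_def lookup_minus r0 minus_div_mult_eq_mod)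
    have "\<not> 0 < nat (ix s)"
    proof
      assume "0 < nat (ix s)"
      with s have "n \<le> nat (ix s)" by (intro n_min) (auto simp: Q_def)
      moreover have "ix s < int n" using ixs n_pos by simp
      ultimately show False using \<open>0 < nat (ix s)\<close> by linarith
    qed
    moreover have "ix s \<ge> 0" using ixs n_pos by simp
    ultimately have "ix s = 0" by simp
    with s show ?thesis by (auto simp: s_def intro!: exI[of _ "ix r div int n"] exI[of _ s])
  qed
  define v where "v x = K0 x r0 - \<psi> 0 0 x" for x
  \<comment> \<open>The orbit of x under translation by r0 is parametrised from its unique point with
      coordinate in 0, ..., n - 1; q counts the translations from there to x, and u
      is zero at that point.\<close>
  define q where "q x = ix x div int n" for x
  define u where "u x = int_sum (\<lambda>m. v (x + frag_cmul (m - q x) r0)) (q x)" for x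
  have u_r0: "u (x + r0) = u x + v x" for x
  proof -
    have "q (x + r0) = q x + 1"
      using n_pos by (simp add: q_def lookup_add r0)
    moreover have "x + r0 + frag_cmul (m - (q x + 1)) r0 = x + frag_cmul (m - q x) r0" for m
      by (simp add: frag_cmul_diff_distrib frag_cmul_distrib algebra_simps)
    ultimately show ?thesis by (simp only: u_def int_sum_Suc) simp
  qed
  have v_s: "v (x + s) \<simeq> v x" if "s \<in> R" "ix s = 0" for x s
    using K0_period[OF that, of x r0] that by (auto simp: v_def period3 intro!: cong_diff)
  have u_s: "u (x + s) \<simeq> u x" if "s \<in> R" "ix s = 0" for x s
  proof -
    have "q (x + s) = q x" using that by (simp add: q_def lookup_add)
    moreover have "v (x + s + frag_cmul m r0) \<simeq> v (x + frag_cmul m r0)" for m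
      using v_s[OF that, of "x + frag_cmul m r0"] by (simp add: ac_simps)
    ultimately show ?thesis
      unfolding u_def by (auto intro!: int_sum_cong)
  qed
  define K where "K x y = K0 x y + u x + u y - u (x + y)" for x y
  have K_sym: "K x y \<simeq> K y x" for x y
    by (rule cong_by[OF K0_sym[of x y]]) (simp add: K_def add.commute algebra_simps)
  have K_cobound: "cobound2 K x y z \<simeq> \<psi> x y z" for x y z
    by (rule cong_by[OF K0_cobound[of x y z]]) (simp add: K_def cobound2_def algebra_simps)
  have K_s: "K (x + s) y \<simeq> K x y" if "s \<in> R" "ix s = 0" for x y s
    by (rule cong_by[OF cong_add[OF K0_period[OF that, of x y]
          cong_diff[OF u_s[OF that, of x] u_s[OF that, of "x + y"]]]])
       (simp add: K_def algebra_simps)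
  have K_r0': "K x r0 = \<psi> 0 0 x + u r0" for x
    by (simp add: K_def u_r0 v_def)
  have K_r0_right: "K x (y + r0) \<simeq> K x y" for x y
  proof -
    have z: "\<psi> x y r0 \<simeq> \<psi> 0 0 y - \<psi> 0 0 (x + y)"
      using zero_right[of x y] period3[OF r0(1), of x y 0] by simp
    show ?thesis
      by (rule cong_by[OF cong_add[OF K_cobound[of x y r0] z]]) (simp add: cobound2_def K_r0')
  qed
  have K_r0: "K (x + r0) y \<simeq> K x y" for x y
    by (rule cong_trans[OF K_sym cong_trans[OF K_r0_right K_sym]])
  have "K (x + r) y \<simeq> K x y" if r: "r \<in> R" for r x y
  proof -
    obtain m s where s: "s \<in> R" "ix s = 0" "r = s + frag_cmul m r0"
      using R_split[OF r] by blast
    have "K (x + r) y = K ((x + s) + frag_cmul m r0) y"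
      by (simp add: s add.assoc)
    also have "\<dots> \<simeq> K (x + s) y"
      by (rule periodic_cong[of "\<lambda>x. K x y"]) (rule K_r0)
    also have "\<dots> \<simeq> K x y" using s by (intro K_s)
    finally show ?thesis .
  qed
  with K_sym K_cobound show ?thesis by blast
qed

end

text \<open>
  The set \<open>S\<close> contains the coordinates on which \<open>\<psi>\<close> depends. The invariance under \<open>R\<close> is carried
  through the induction so that the solution descends to the quotient by \<open>R\<close>.
\<close>

theorem strict_symmetric_cocycle_cobounds:
  fixes \<psi> :: "('i \<Rightarrow>\<^sub>0 int) \<Rightarrow> ('i \<Rightarrow>\<^sub>0 int) \<Rightarrow> ('i \<Rightarrow>\<^sub>0 int) \<Rightarrow> 'u::ab_group_add"
  assumes "finite S" and "strict_symmetric_cocycle N \<psi>"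
    and "0 \<in> R" "\<And>r s. r \<in> R \<Longrightarrow> s \<in> R \<Longrightarrow> r - s \<in> R"
    and "\<And>i. i \<notin> S \<Longrightarrow> frag_of i \<in> R"
    and "\<And>r x y z. r \<in> R \<Longrightarrow> \<psi> (x + r) y z = \<psi> x y z"
    and "\<And>r x y z. r \<in> R \<Longrightarrow> \<psi> x (y + r) z = \<psi> x y z"
    and "\<And>r x y z. r \<in> R \<Longrightarrow> \<psi> x y (z + r) = \<psi> x y z"
  shows "\<exists>K. (\<forall>x y. K x y - K y x \<in> N) \<and> (\<forall>x y z. cobound2 K x y z - \<psi> x y z \<in> N)
     \<and> (\<forall>r\<in>R. \<forall>x y. K (x + r) y - K x y \<in> N)"
  using assms
proof (induction S arbitrary: \<psi> R rule: finite_induct)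
  case empty
  interpret strict_symmetric_cocycle N \<psi> by (rule empty.prems)
  have "r \<in> R" for r
    using empty.prems(2-4) by (intro frag_induction[of r UNIV "\<lambda>r. r \<in> R"]) auto
  then have const: "\<psi> x y z = \<psi> 0 0 0" for x y z
    using empty.prems(5)[of x 0 y z] empty.prems(6)[of y 0 0 z] empty.prems(7)[of z 0 0 0] by simp
  have "cobound2 (\<lambda>_ _. 0) x y z - \<psi> x y z \<in> N" for x y z
    using cong_sym[OF palindrome[of 0 0]] unfolding const[of x y z] by (simp add: cobound2_def cong_def)
  then show ?case by (intro exI[of _ "\<lambda>_ _. 0"]) (simp add: zero_mem)
next
  case (insert a S)
  interpret strict_symmetric_cocycle N \<psi> by (rule insert.prems)
  define pr where "pr x = x - frag_cmul (Poly_Mapping.lookup x a) (frag_of a)" for x :: "'i \<Rightarrow>\<^sub>0 int"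
  have pr_add: "pr (x + y) = pr x + pr y" for x y
    by (simp add: pr_def lookup_add frag_cmul_distrib)
  have pr_diff: "pr (x - y) = pr x - pr y" for x y
    using pr_add[of "x - y" y] by (simp add: algebra_simps)
  have pr_0: "pr 0 = 0" by (simp add: pr_def)
  have "\<exists>K. (\<forall>x y. K x y - K y x \<in> N) \<and> (\<forall>x y z. cobound2 K x y z - \<psi> (pr x) (pr y) (pr z) \<in> N)
     \<and> (\<forall>r\<in>{r. pr r \<in> R}. \<forall>x y. K (x + r) y - K x y \<in> N)"
  \<comment> \<open>Projecting the coordinate a away makes frag_of a a period, so that the new cocycle
      depends on the coordinates in S only.\<close>
  proof (rule insert.IH)
    show "strict_symmetric_cocycle N (\<lambda>x y z. \<psi> (pr x) (pr y) (pr z))"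
      by unfold_locales (simp_all add: pr_add cocycle hexagon)
    show "frag_of i \<in> {r. pr r \<in> R}" if "i \<notin> S" for i
      using that insert.prems(2,4) by (cases "i = a") (auto simp: pr_def)
  qed (use insert.prems pr_0 in \<open>auto simp: pr_add pr_diff\<close>)
  then obtain k where k: "\<And>x y. k x y \<simeq> k y x"
      "\<And>x y z. cobound2 k x y z \<simeq> \<psi> (pr x) (pr y) (pr z)"
      "\<And>r x y. pr r \<in> R \<Longrightarrow> k (x + r) y \<simeq> k x y"
    unfolding cong_def by blast
  interpret coordinate_step N \<psi> a R k
    by unfold_locales (use insert.prems k in \<open>auto simp: pr_def\<close>)
  show ?case using extension unfolding cong_def .
qed

section \<open>The bar complex\<close>

lemma frag_induct:
  "P 0 \<Longrightarrow> (\<And>x. P (frag_of x)) \<Longrightarrow> (\<And>a b. P a \<Longrightarrow> P b \<Longrightarrow> P (a - b)) \<Longrightarrow> P c"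
  by (rule frag_induction[of c UNIV]) auto

lemma frag_extend_frag_extend:
  "frag_extend f (frag_extend g c) = frag_extend (\<lambda>x. frag_extend f (g x)) c"
  by (induction c rule: frag_induct) (auto simp: frag_extend_diff)

lemma frag_extend_pointwise_add:
  "frag_extend (\<lambda>x. f x + g x) c = frag_extend f c + frag_extend g c"
  by (induction c rule: frag_induct) (auto simp: frag_extend_diff)

lemma frag_extend_pointwise_diff:
  "frag_extend (\<lambda>x. f x - g x) c = frag_extend f c - frag_extend g c"
  by (induction c rule: frag_induct) (auto simp: frag_extend_diff)

lemma frag_extend_pointwise_minus:
  "frag_extend (\<lambda>x. - f x) c = - frag_extend f c"
  by (induction c rule: frag_induct) (auto simp: frag_extend_diff)

abbreviation bar_chains :: "nat \<Rightarrow> ('a, 'm) monoid_scheme \<Rightarrow> 'a bar_chain set" where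
  "bar_chains n G \<equiv> carrier (bar_chain_group n G)"

lemma bar_chains_iff: "c \<in> bar_chains n G \<longleftrightarrow> Poly_Mapping.keys c \<subseteq> bar_simplices n G"
  by (simp add: bar_chain_group_def)

lemma bar_chains_zero [simp]: "0 \<in> bar_chains n G"
  and bar_chains_of [simp]: "frag_of xs \<in> bar_chains n G \<longleftrightarrow> xs \<in> bar_simplices n G"
  by (simp_all add: bar_chains_iff)

lemma bar_chains_add: "c \<in> bar_chains n G \<Longrightarrow> d \<in> bar_chains n G \<Longrightarrow> c + d \<in> bar_chains n G"
  unfolding bar_chains_iff by (meson Un_least keys_add order_trans)

lemma bar_chains_diff: "c \<in> bar_chains n G \<Longrightarrow> d \<in> bar_chains n G \<Longrightarrow> c - d \<in> bar_chains n G"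
  unfolding bar_chains_iff by (meson Un_least keys_diff order_trans)

lemma bar_chains_uminus [simp]: "- c \<in> bar_chains n G \<longleftrightarrow> c \<in> bar_chains n G"
  by (simp add: bar_chains_iff)

lemma bar_chains_cmul: "c \<in> bar_chains n G \<Longrightarrow> frag_cmul k c \<in> bar_chains n G"
  unfolding bar_chains_iff using keys_cmul by fast

lemma bar_chains_sum: "(\<And>i. i \<in> I \<Longrightarrow> f i \<in> bar_chains n G) \<Longrightarrow> sum f I \<in> bar_chains n G"
  by (induction I rule: infinite_finite_induct) (auto intro: bar_chains_add)

lemma bar_chains_extend:
  assumes "c \<in> bar_chains n G" "\<And>xs. xs \<in> bar_simplices n G \<Longrightarrow> f xs \<in> bar_chains m H"
  shows "frag_extend f c \<in> bar_chains m H"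
  using assms unfolding bar_chains_iff by (intro order_trans[OF keys_frag_extend]) blast

lemma frag_extend_chain_cong:
  assumes "c \<in> bar_chains n G" "\<And>xs. xs \<in> bar_simplices n G \<Longrightarrow> f xs = g xs"
  shows "frag_extend f c = frag_extend g c"
  using assms by (intro frag_extend_eq) (auto simp: bar_chains_iff)

lemma bar_simplices_2E:
  assumes "xs \<in> bar_simplices 2 G"
  obtains x y where "xs = [x, y]" "x \<in> carrier G" "y \<in> carrier G"
  using assms by (auto simp: bar_simplices_def numeral_eq_Suc length_Suc_conv)

lemma bar_simplices_3E:
  assumes "xs \<in> bar_simplices 3 G"
  obtains x y z where "xs = [x, y, z]" "x \<in> carrier G" "y \<in> carrier G" "z \<in> carrier G"
  using assms by (auto simp: bar_simplices_def numeral_eq_Suc length_Suc_conv)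

lemma bar_simplices_4E:
  assumes "xs \<in> bar_simplices 4 G"
  obtains x y z w where "xs = [x, y, z, w]"
    "x \<in> carrier G" "y \<in> carrier G" "z \<in> carrier G" "w \<in> carrier G"
  using assms by (auto simp: bar_simplices_def numeral_eq_Suc length_Suc_conv)

lemma bar_boundary_add: "bar_boundary G (c + d) = bar_boundary G c + bar_boundary G d"
  and bar_boundary_diff: "bar_boundary G (c - d) = bar_boundary G c - bar_boundary G d"
  and bar_boundary_minus: "bar_boundary G (- c) = - bar_boundary G c"
  and bar_boundary_0 [simp]: "bar_boundary G 0 = 0"
  by (simp_all add: bar_boundary_def frag_extend_add frag_extend_diff frag_extend_minus)

lemma bar_boundary_extend:
  "bar_boundary G (frag_extend f c) = frag_extend (\<lambda>xs. bar_boundary G (f xs)) c"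
  by (simp add: bar_boundary_def frag_extend_frag_extend)

lemma bar_boundary_expand: "bar_boundary G c = frag_extend (\<lambda>xs. bar_boundary G (frag_of xs)) c"
  by (simp add: bar_boundary_def)

lemma bar_boundary_nil [simp]: "bar_boundary G (frag_of []) = 0"
  by (simp add: bar_boundary_def)

lemma bar_boundary_1 [simp]: "bar_boundary G (frag_of [x]) = 0"
  by (simp add: bar_boundary_def bar_face_def)

lemma bar_boundary_2 [simp]:
  "bar_boundary G (frag_of [x, y]) = frag_of [y] - frag_of [x \<otimes>\<^bsub>G\<^esub> y] + frag_of [x]"
  by (simp add: bar_boundary_def bar_face_def numeral_eq_Suc)

lemma bar_boundary_3 [simp]:
  "bar_boundary G (frag_of [x, y, z]) =
     frag_of [y, z] - frag_of [x \<otimes>\<^bsub>G\<^esub> y, z] + frag_of [x, y \<otimes>\<^bsub>G\<^esub> z] - frag_of [x, y]"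
  by (simp add: bar_boundary_def bar_face_def numeral_eq_Suc)

lemma bar_boundary_4 [simp]:
  "bar_boundary G (frag_of [x, y, z, w]) =
     frag_of [y, z, w] - frag_of [x \<otimes>\<^bsub>G\<^esub> y, z, w] + frag_of [x, y \<otimes>\<^bsub>G\<^esub> z, w]
     - frag_of [x, y, z \<otimes>\<^bsub>G\<^esub> w] + frag_of [x, y, z]"
  by (simp add: bar_boundary_def bar_face_def numeral_eq_Suc)

lemma (in group) bar_face_simplex:
  assumes "xs \<in> bar_simplices (Suc n) G" "i \<le> Suc n"
  shows "bar_face G i xs \<in> bar_simplices n G"
proof -
  from assms have len: "length xs = Suc n" and sub: "set xs \<subseteq> carrier G"
    by (auto simp: bar_simplices_def)
  have "set (tl xs) \<subseteq> carrier G" using sub by (cases xs) auto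
  moreover have "set (butlast xs) \<subseteq> carrier G" using sub by (auto dest: in_set_butlastD)
  moreover have "set (take m xs) \<subseteq> carrier G" "set (drop m xs) \<subseteq> carrier G" for m
    using sub set_take_subset set_drop_subset by fast+
  moreover have "xs ! j \<in> carrier G" if "j < Suc n" for j
    using that len sub nth_mem by force
  ultimately show ?thesis
    using len assms(2) by (auto simp: bar_face_def bar_simplices_def)
qed

lemma (in group) bar_boundary_chain:
  assumes "c \<in> bar_chains (Suc n) G"
  shows "bar_boundary G c \<in> bar_chains n G"
  unfolding bar_boundary_def
proof (rule bar_chains_extend[OF assms])
  fix xs assume xs: "xs \<in> bar_simplices (Suc n) G"
  then have "length xs = Suc n" by (simp add: bar_simplices_def)
  then show "(if xs = [] then 0 else \<Sum>i\<le>length xs. frag_cmul ((- 1) ^ i) (frag_of (bar_face G i xs)))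
      \<in> bar_chains n G"
    using bar_face_simplex[OF xs]
    by (auto simp del: sum.atMost_Suc intro!: bar_chains_sum bar_chains_cmul)
qed

text \<open>
  The degrees needed for homology up to degree three; on simplices of fixed length the cancellation
  is a computation that uses only associativity.
\<close>

lemma (in group) bar_boundary_boundary:
  assumes "c \<in> bar_chains n G" "n \<in> {2, 3, 4}"
  shows "bar_boundary G (bar_boundary G c) = 0"
proof -
  have "bar_boundary G (bar_boundary G (frag_of xs)) = 0" if "xs \<in> bar_simplices n G" for xs
    using that assms(2)
    by (auto elim!: bar_simplices_2E bar_simplices_3E bar_simplices_4E
        simp: bar_boundary_add bar_boundary_diff m_assoc)
  then have "frag_extend (\<lambda>xs. bar_boundary G (bar_boundary G (frag_of xs))) c = 0"
    using assms(1) by (intro frag_extend_eq_0) (auto simp: bar_chains_iff)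
  then show ?thesis
    by (subst bar_boundary_expand) (simp add: bar_boundary_extend)
qed

lemma bar_map_of [simp]: "bar_map f (frag_of xs) = frag_of (map f xs)"
  and bar_map_add: "bar_map f (c + d) = bar_map f c + bar_map f d"
  and bar_map_diff: "bar_map f (c - d) = bar_map f c - bar_map f d"
  and bar_map_minus: "bar_map f (- c) = - bar_map f c"
  and bar_map_0 [simp]: "bar_map f 0 = 0"
  by (simp_all add: bar_map_def frag_extend_add frag_extend_diff frag_extend_minus)

lemma bar_map_chain:
  assumes "c \<in> bar_chains n G" "f \<in> carrier G \<rightarrow> carrier H"
  shows "bar_map f c \<in> bar_chains n H"
  unfolding bar_map_def using assms(2)
  by (intro bar_chains_extend[OF assms(1)]) (auto simp: bar_simplices_def)

lemma bar_face_map: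
  assumes "f \<in> hom G H" "xs \<in> bar_simplices n G" "i \<le> n"
  shows "bar_face H i (map f xs) = map f (bar_face G i xs)"
proof -
  from assms have len: "length xs = n" and sub: "set xs \<subseteq> carrier G"
    by (auto simp: bar_simplices_def)
  have "f (xs ! (i - 1) \<otimes>\<^bsub>G\<^esub> xs ! i) = f (xs ! (i - 1)) \<otimes>\<^bsub>H\<^esub> f (xs ! i)" if "i < n"
  proof -
    have "xs ! (i - 1) \<in> carrier G" "xs ! i \<in> carrier G"
      using that len sub nth_mem[of "i - 1" xs] nth_mem[of i xs] by auto
    with assms(1) show ?thesis by (simp add: hom_mult)
  qed
  with assms(3) len show ?thesis
    by (auto simp: bar_face_def map_tl map_butlast take_map drop_map)
qed

lemma bar_boundary_map:
  assumes "f \<in> hom G H" "c \<in> bar_chains n G"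
  shows "bar_boundary H (bar_map f c) = bar_map f (bar_boundary G c)"
proof -
  have "bar_boundary H (frag_of (map f xs)) = bar_map f (bar_boundary G (frag_of xs))"
    if "xs \<in> bar_simplices n G" for xs
  proof -
    have "length xs = n" using that by (simp add: bar_simplices_def)
    then show ?thesis
      using bar_face_map[OF assms(1) that]
      by (auto simp: bar_boundary_def bar_map_def frag_extend_sum frag_extend_cmul intro!: sum.cong)
  qed
  then have "frag_extend (\<lambda>xs. bar_boundary H (frag_of (map f xs))) c
      = frag_extend (\<lambda>xs. bar_map f (bar_boundary G (frag_of xs))) c"
    by (rule frag_extend_chain_cong[OF assms(2)])
  then show ?thesis
    by (subst bar_boundary_expand[of G c])
       (simp add: bar_map_def bar_boundary_extend frag_extend_frag_extend)
qed

section \<open>The Leibniz rule for the cross product\<close>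

lemma bar_cross_of [simp]: "bar_cross G H (frag_of xs) (frag_of ys) = bar_shuffle G H xs ys"
  by (simp add: bar_cross_def)

lemma bar_cross_of_left: "bar_cross G H (frag_of xs) d = frag_extend (\<lambda>ys. bar_shuffle G H xs ys) d"
  by (simp add: bar_cross_def)

lemma bar_cross_add_left: "bar_cross G H (c + c') d = bar_cross G H c d + bar_cross G H c' d"
  and bar_cross_diff_left: "bar_cross G H (c - c') d = bar_cross G H c d - bar_cross G H c' d"
  and bar_cross_minus_left: "bar_cross G H (- c) d = - bar_cross G H c d"
  by (simp_all add: bar_cross_def frag_extend_add frag_extend_diff frag_extend_minus)

lemma bar_cross_0_right [simp]: "bar_cross G H c 0 = 0"
  by (simp add: bar_cross_def frag_extend_eq_0)

lemma bar_cross_add_right: "bar_cross G H c (d + d') = bar_cross G H c d + bar_cross G H c d'"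
  and bar_cross_diff_right: "bar_cross G H c (d - d') = bar_cross G H c d - bar_cross G H c d'"
  by (simp_all add: bar_cross_def frag_extend_add frag_extend_diff
      frag_extend_pointwise_add frag_extend_pointwise_diff)

lemma bar_cross_extend_left:
  "bar_cross G H (frag_extend f c) d = frag_extend (\<lambda>xs. bar_cross G H (f xs) d) c"
  by (simp add: bar_cross_def frag_extend_frag_extend)

lemma bar_cross_extend_right:
  "bar_cross G H c (frag_extend f d) = frag_extend (\<lambda>xs. bar_cross G H c (f xs)) d"
  by (induction d rule: frag_induct)
     (auto simp: frag_extend_diff bar_cross_diff_right)

lemma bar_shuffle_chain:
  assumes "group G" "group H" "xs \<in> bar_simplices p G" "ys \<in> bar_simplices q H"
  shows "bar_shuffle G H xs ys \<in> bar_chains (p + q) (G \<times>\<times> H)"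
proof -
  interpret G: group G by fact
  interpret H: group H by fact
  have cons: "frag_extend (\<lambda>zs. frag_of (z # zs)) c \<in> bar_chains (Suc n) (G \<times>\<times> H)"
    if "c \<in> bar_chains n (G \<times>\<times> H)" "z \<in> carrier (G \<times>\<times> H)" for c n z
    using that by (intro bar_chains_extend[OF that(1)]) (auto simp: bar_simplices_def)
  have "set xs \<subseteq> carrier G \<Longrightarrow> set ys \<subseteq> carrier H \<Longrightarrow>
    bar_shuffle G H xs ys \<in> bar_chains (length xs + length ys) (G \<times>\<times> H)"
  proof (induction xs arbitrary: ys)
    case (Cons x xs)
    note IH = Cons.IH
    show ?case using Cons.prems
    proof (induction ys)
      case (Cons y ys)
      have 1: "bar_shuffle G H xs (y # ys) \<in> bar_chains (length xs + length (y # ys)) (G \<times>\<times> H)"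
        using IH[of "y # ys"] Cons.prems by simp
      have 2: "bar_shuffle G H (x # xs) ys \<in> bar_chains (length (x # xs) + length ys) (G \<times>\<times> H)"
        using Cons by simp
      show ?case
        using Cons.prems cons[OF 1, of "(x, \<one>\<^bsub>H\<^esub>)"] cons[OF 2, of "(\<one>\<^bsub>G\<^esub>, y)"]
        by (auto intro!: bar_chains_add bar_chains_cmul)
    qed (auto simp: bar_simplices_def)
  qed (auto simp: bar_simplices_def)
  with assms show ?thesis by (auto simp: bar_simplices_def)
qed

lemma bar_cross_chain:
  assumes "group G" "group H" "c \<in> bar_chains p G" "d \<in> bar_chains q H"
  shows "bar_cross G H c d \<in> bar_chains (p + q) (G \<times>\<times> H)"
  unfolding bar_cross_def
  by (intro bar_chains_extend[OF assms(3)] bar_chains_extend[OF assms(4)] bar_shuffle_chain assms)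

context
  fixes G :: "('a, 'm) monoid_scheme" and H :: "('b, 'n) monoid_scheme"
  assumes G: "group G" and H: "group H"
begin

interpretation G: group G by (rule G)
interpretation H: group H by (rule H)

text \<open>
  The Leibniz rule is needed only in bidegrees \<open>(1,2)\<close>, \<open>(1,3)\<close> and \<open>(2,2)\<close>. There it can be checked on
  simplices by expanding the finitely many shuffles; the boundary of a 1-simplex is zero, so in
  bidegrees \<open>(1,q)\<close> the first term is absent.
\<close>

lemma Leibniz_1_2_simplex:
  assumes "x \<in> carrier G" "ys \<in> bar_simplices 2 H"
  shows "bar_boundary (G \<times>\<times> H) (bar_shuffle G H [x] ys) =
    - bar_cross G H (frag_of [x]) (bar_boundary H (frag_of ys))"
  using assms
  by (auto elim!: bar_simplices_2E simp: bar_boundary_add bar_boundary_diff bar_boundary_minus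
      bar_cross_add_right bar_cross_diff_right frag_extend_add frag_extend_diff frag_extend_minus frag_extend_cmul)

lemma Leibniz_1_3_simplex:
  assumes "x \<in> carrier G" "ys \<in> bar_simplices 3 H"
  shows "bar_boundary (G \<times>\<times> H) (bar_shuffle G H [x] ys) =
    - bar_cross G H (frag_of [x]) (bar_boundary H (frag_of ys))"
  using assms
  by (auto elim!: bar_simplices_3E simp: bar_boundary_add bar_boundary_diff bar_boundary_minus
      bar_cross_add_right bar_cross_diff_right frag_extend_add frag_extend_diff frag_extend_minus frag_extend_cmul)

lemma Leibniz_2_2_simplex:
  assumes "xs \<in> bar_simplices 2 G" "ys \<in> bar_simplices 2 H"
  shows "bar_boundary (G \<times>\<times> H) (bar_shuffle G H xs ys) =
    bar_cross G H (bar_boundary G (frag_of xs)) (frag_of ys) +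
    bar_cross G H (frag_of xs) (bar_boundary H (frag_of ys))"
  using assms
  by (auto elim!: bar_simplices_2E simp: bar_boundary_add bar_boundary_diff bar_boundary_minus
      bar_cross_add_right bar_cross_diff_right bar_cross_add_left bar_cross_diff_left
      frag_extend_add frag_extend_diff frag_extend_minus frag_extend_cmul)

end

lemma Leibniz_1:
  assumes "group G" "group H" "x \<in> carrier G" "d \<in> bar_chains q H" "q \<in> {2, 3}"
  shows "bar_boundary (G \<times>\<times> H) (bar_cross G H (frag_of [x]) d)
    = - bar_cross G H (frag_of [x]) (bar_boundary H d)"
proof -
  have "bar_boundary (G \<times>\<times> H) (bar_cross G H (frag_of [x]) d)
      = frag_extend (\<lambda>ys. bar_boundary (G \<times>\<times> H) (bar_shuffle G H [x] ys)) d"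
    by (simp add: bar_cross_of_left bar_boundary_extend)
  also have "\<dots> = frag_extend (\<lambda>ys. - bar_cross G H (frag_of [x]) (bar_boundary H (frag_of ys))) d"
    using assms(5) Leibniz_1_2_simplex[OF assms(1-3)] Leibniz_1_3_simplex[OF assms(1-3)]
    by (intro frag_extend_chain_cong[OF assms(4)]) auto
  also have "\<dots> = - bar_cross G H (frag_of [x]) (bar_boundary H d)"
    by (subst bar_boundary_expand[of H d])
       (simp add: frag_extend_pointwise_minus bar_cross_extend_right)
  finally show ?thesis .
qed

lemma Leibniz_2_2:
  assumes "group G" "group H" "c \<in> bar_chains 2 G" "d \<in> bar_chains 2 H"
  shows "bar_boundary (G \<times>\<times> H) (bar_cross G H c d)
    = bar_cross G H (bar_boundary G c) d + bar_cross G H c (bar_boundary H d)"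
proof -
  have "bar_boundary (G \<times>\<times> H) (bar_cross G H c d)
      = frag_extend (\<lambda>xs. frag_extend (\<lambda>ys. bar_boundary (G \<times>\<times> H) (bar_shuffle G H xs ys)) d) c"
    by (simp add: bar_cross_def bar_boundary_extend)
  also have "\<dots> = frag_extend (\<lambda>xs. frag_extend (\<lambda>ys. bar_cross G H (bar_boundary G (frag_of xs)) (frag_of ys)
      + bar_cross G H (frag_of xs) (bar_boundary H (frag_of ys))) d) c"
    by (intro frag_extend_chain_cong[OF assms(3)] frag_extend_chain_cong[OF assms(4)]
        Leibniz_2_2_simplex assms)
  also have "\<dots> = frag_extend (\<lambda>xs. bar_cross G H (bar_boundary G (frag_of xs)) d) c
      + frag_extend (\<lambda>xs. bar_cross G H (frag_of xs) (bar_boundary H d)) c"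
  proof -
    have "frag_extend (\<lambda>ys. bar_cross G H b (frag_of ys)) d = bar_cross G H b d" for b
      using bar_cross_extend_right[of G H b frag_of d] by (simp flip: frag_expansion)
    moreover have "frag_extend (\<lambda>ys. bar_cross G H b (bar_boundary H (frag_of ys))) d
        = bar_cross G H b (bar_boundary H d)" for b
      by (subst bar_boundary_expand[of H d]) (simp add: bar_cross_extend_right)
    ultimately show ?thesis by (simp add: frag_extend_pointwise_add)
  qed
  also have "frag_extend (\<lambda>xs. bar_cross G H (bar_boundary G (frag_of xs)) d) c
      = bar_cross G H (bar_boundary G c) d"
    by (subst bar_boundary_expand[of G c]) (simp add: bar_cross_extend_left)
  also have "frag_extend (\<lambda>xs. bar_cross G H (frag_of xs) (bar_boundary H d)) c
      = bar_cross G H c (bar_boundary H d)"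
    using bar_cross_extend_left[of G H frag_of c] by (simp flip: frag_expansion)
  finally show ?thesis .
qed

section \<open>Homology groups\<close>

lemma bar_cyclesI: "c \<in> bar_chains n G \<Longrightarrow> bar_boundary G c = 0 \<Longrightarrow> c \<in> bar_cycles n G"
  by (simp add: bar_cycles_def)

lemma bar_cyclesD: "c \<in> bar_cycles n G \<Longrightarrow> c \<in> bar_chains n G"
  "c \<in> bar_cycles n G \<Longrightarrow> bar_boundary G c = 0"
  by (simp_all add: bar_cycles_def)

lemma bar_cycles_0 [simp]: "0 \<in> bar_cycles n G"
  by (simp add: bar_cycles_def)

lemma bar_cycles_add: "c \<in> bar_cycles n G \<Longrightarrow> d \<in> bar_cycles n G \<Longrightarrow> c + d \<in> bar_cycles n G"
  by (simp add: bar_cycles_def bar_chains_add bar_boundary_add)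

lemma bar_cycles_diff: "c \<in> bar_cycles n G \<Longrightarrow> d \<in> bar_cycles n G \<Longrightarrow> c - d \<in> bar_cycles n G"
  by (simp add: bar_cycles_def bar_chains_diff bar_boundary_diff)

lemma bar_boundariesI: "e \<in> bar_chains (Suc n) G \<Longrightarrow> c = bar_boundary G e \<Longrightarrow> c \<in> bar_boundaries n G"
  by (auto simp: bar_boundaries_def)

lemma bar_boundaries_0 [simp]: "0 \<in> bar_boundaries n G"
  by (rule bar_boundariesI[of 0]) auto

lemma bar_boundaries_add:
  "c \<in> bar_boundaries n G \<Longrightarrow> d \<in> bar_boundaries n G \<Longrightarrow> c + d \<in> bar_boundaries n G"
  by (auto simp: bar_boundaries_def bar_chains_add simp flip: bar_boundary_add)

lemma bar_boundaries_diff: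
  "c \<in> bar_boundaries n G \<Longrightarrow> d \<in> bar_boundaries n G \<Longrightarrow> c - d \<in> bar_boundaries n G"
  by (auto simp: bar_boundaries_def bar_chains_diff simp flip: bar_boundary_diff)

lemma bar_cycle_group_simps [simp]:
  "carrier (bar_cycle_group n G) = bar_cycles n G"
  "x \<otimes>\<^bsub>bar_cycle_group n G\<^esub> y = x + y"
  "\<one>\<^bsub>bar_cycle_group n G\<^esub> = 0"
  by (simp_all add: bar_cycle_group_def bar_chain_group_def)

lemma comm_group_bar_cycle_group: "comm_group (bar_cycle_group n G)"
proof (rule comm_groupI)
  fix x assume "x \<in> carrier (bar_cycle_group n G)"
  then show "\<exists>y\<in>carrier (bar_cycle_group n G). y \<otimes>\<^bsub>bar_cycle_group n G\<^esub> x = \<one>\<^bsub>bar_cycle_group n G\<^esub>"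
    using bar_cycles_diff[of 0 n G x] by (intro bexI[of _ "- x"]) auto
qed (auto simp: bar_cycles_add algebra_simps)

lemma bar_cycle_group_inv: "x \<in> bar_cycles n G \<Longrightarrow> inv\<^bsub>bar_cycle_group n G\<^esub> x = - x"
  using bar_cycles_diff[of 0 n G x]
  by (intro group.inv_equality comm_group.axioms(2) comm_group_bar_cycle_group) auto

lemma homology_class_iff: "x \<in> homology_class n G c \<longleftrightarrow> x - c \<in> bar_boundaries n G"
proof -
  have "x \<in> homology_class n G c \<longleftrightarrow> (\<exists>b\<in>bar_boundaries n G. x = b + c)"
    by (auto simp: homology_class_def r_coset_def)
  then show ?thesis by (metis add_diff_cancel diff_add_cancel)
qed

lemma homology_class_eq:
  "homology_class n G c = homology_class n G d \<longleftrightarrow> c - d \<in> bar_boundaries n G"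
proof
  assume "c - d \<in> bar_boundaries n G"
  then have "x - c \<in> bar_boundaries n G \<longleftrightarrow> x - d \<in> bar_boundaries n G" for x
    using bar_boundaries_add[of "x - c" n G "c - d"] bar_boundaries_diff[of "x - d" n G "c - d"]
    by auto
  then show "homology_class n G c = homology_class n G d"
    by (auto simp: homology_class_iff)
next
  assume "homology_class n G c = homology_class n G d"
  moreover have "c \<in> homology_class n G c" by (simp add: homology_class_iff)
  ultimately show "c - d \<in> bar_boundaries n G" by (simp add: homology_class_iff)
qed

lemma carrier_group_homology: "carrier (group_homology n G) = homology_class n G ` bar_cycles n G"
  by (auto simp: group_homology_def carrier_FactGroup homology_class_def)

lemma (in group) bar_boundaries_subset:
  "n \<in> {1, 2, 3} \<Longrightarrow> bar_boundaries n G \<subseteq> bar_cycles n G"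
  using bar_boundary_boundary[of _ "Suc n"] bar_boundary_chain[of _ n]
  by (auto simp: bar_boundaries_def bar_cycles_def numeral_eq_Suc)

lemma (in group) subgroup_bar_boundaries:
  assumes "n \<in> {1, 2, 3}"
  shows "subgroup (bar_boundaries n G) (bar_cycle_group n G)"
proof (rule group.subgroupI)
  show "group (bar_cycle_group n G)"
    using comm_group_bar_cycle_group by (rule comm_group.axioms)
  show "bar_boundaries n G \<noteq> {}" using bar_boundaries_0 by blast
next
  fix x assume "x \<in> bar_boundaries n G"
  then show "inv\<^bsub>bar_cycle_group n G\<^esub> x \<in> bar_boundaries n G"
    using bar_boundaries_subset[OF assms] bar_boundaries_diff[of 0 n G x]
    by (auto simp: bar_cycle_group_inv subset_iff)
qed (use bar_boundaries_subset[OF assms] in \<open>auto simp: bar_boundaries_add\<close>)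

lemma (in group) comm_group_homology:
  "n \<in> {1, 2, 3} \<Longrightarrow> comm_group (group_homology n G)"
  unfolding group_homology_def
  by (intro comm_group.abelian_FactGroup comm_group_bar_cycle_group subgroup_bar_boundaries)

lemma (in group) homology_class_mult:
  assumes "n \<in> {1, 2, 3}" "c \<in> bar_cycles n G" "d \<in> bar_cycles n G"
  shows "homology_class n G c \<otimes>\<^bsub>group_homology n G\<^esub> homology_class n G d = homology_class n G (c + d)"
proof -
  interpret Z: comm_group "bar_cycle_group n G" by (rule comm_group_bar_cycle_group)
  have "bar_boundaries n G \<lhd> bar_cycle_group n G"
    using subgroup_bar_boundaries[OF assms(1)] by (simp add: Z.normal_iff_subgroup)
  from normal.rcos_sum[OF this] assms(2,3) show ?thesis
    by (simp add: homology_class_def group_homology_def)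
qed

lemma homology_class_0: "\<one>\<^bsub>group_homology n G\<^esub> = homology_class n G 0"
  by (auto simp: group_homology_def homology_class_iff)

text \<open>
  The union that defines the map is a union of equal sets, because chain maps send homologous
  cycles to homologous cycles.
\<close>

lemma group_homology_map_class:
  assumes "group G" "group H" "f \<in> hom G H" "n \<in> {1, 2, 3}" "c \<in> bar_cycles n G"
  shows "group_homology_map n G H f (homology_class n G c) = homology_class n H (bar_map f c)"
proof -
  have "homology_class n H (bar_map f d) = homology_class n H (bar_map f c)"
    if "d \<in> homology_class n G c" for d
  proof -
    obtain e where e: "e \<in> bar_chains (Suc n) G" "d - c = bar_boundary G e"
      using \<open>d \<in> homology_class n G c\<close> by (auto simp: homology_class_iff bar_boundaries_def)
    have "bar_map f d - bar_map f c = bar_boundary H (bar_map f e)"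
      using bar_boundary_map[OF assms(3) e(1)] e(2) by (simp flip: bar_map_diff)
    moreover have "bar_map f e \<in> bar_chains (Suc n) H"
      using e(1) assms(3) by (intro bar_map_chain) (auto simp: hom_def)
    ultimately show ?thesis
      by (auto simp: homology_class_eq intro: bar_boundariesI)
  qed
  moreover have "c \<in> homology_class n G c \<inter> bar_cycles n G"
    using assms(5) by (simp add: homology_class_iff)
  ultimately show ?thesis
    unfolding group_homology_map_def by blast
qed

lemma bar_map_cycle:
  assumes "f \<in> hom G H" "c \<in> bar_cycles n G"
  shows "bar_map f c \<in> bar_cycles n H"
  using assms by (auto simp: bar_cycles_def bar_boundary_map bar_map_chain hom_def)

lemma group_homology_map_hom:
  assumes "group G" "group H" "f \<in> hom G H" "n \<in> {1, 2, 3}"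
  shows "group_homology_map n G H f \<in> hom (group_homology n G) (group_homology n H)"
proof (rule homI)
  fix X Y
  assume "X \<in> carrier (group_homology n G)" "Y \<in> carrier (group_homology n G)"
  then obtain c d where c: "X = homology_class n G c" "c \<in> bar_cycles n G"
    and d: "Y = homology_class n G d" "d \<in> bar_cycles n G"
    by (auto simp: carrier_group_homology)
  show "group_homology_map n G H f X \<in> carrier (group_homology n H)"
    using c assms by (simp add: group_homology_map_class carrier_group_homology bar_map_cycle)
  show "group_homology_map n G H f (X \<otimes>\<^bsub>group_homology n G\<^esub> Y) =
      group_homology_map n G H f X \<otimes>\<^bsub>group_homology n H\<^esub> group_homology_map n G H f Y"
    using c d assms
    by (simp add: group.homology_class_mult group_homology_map_class bar_map_cycle
        bar_cycles_add bar_map_add)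
qed

section \<open>Maps out of a tensor product\<close>

lemma (in comm_group) free_Abelian_lift_superset:
  assumes "finite T" "Poly_Mapping.keys u \<subseteq> T" "f \<in> T \<rightarrow> carrier G"
  shows "free_Abelian_lift G f u = finprod G (\<lambda>k. f k [^] Poly_Mapping.lookup u k) T"
  unfolding free_Abelian_lift_def using assms
  by (intro finprod_mono_neutral_cong_left) (auto simp: in_keys_iff)

lemma (in comm_group) free_Abelian_lift_hom:
  assumes "f \<in> S \<rightarrow> carrier G"
  shows "free_Abelian_lift G f \<in> hom (free_Abelian_group S) G"
proof (rule homI)
  fix u assume "u \<in> carrier (free_Abelian_group S)"
  with assms show "free_Abelian_lift G f u \<in> carrier G"
    by (auto simp: free_Abelian_lift_def intro!: finprod_closed)
next
  fix u v assume uv: "u \<in> carrier (free_Abelian_group S)" "v \<in> carrier (free_Abelian_group S)"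
  define T where "T = Poly_Mapping.keys u \<union> Poly_Mapping.keys v"
  have T: "finite T" "f \<in> T \<rightarrow> carrier G" using uv assms by (auto simp: T_def)
  have "free_Abelian_lift G f (u + v) = finprod G (\<lambda>k. f k [^] Poly_Mapping.lookup (u + v) k) T"
    using keys_add[of u v] T by (intro free_Abelian_lift_superset) (auto simp: T_def)
  also have "\<dots> = finprod G (\<lambda>k. f k [^] Poly_Mapping.lookup u k \<otimes> f k [^] Poly_Mapping.lookup v k) T"
    using T by (intro finprod_cong') (auto simp: lookup_add int_pow_mult Pi_iff)
  also have "\<dots> = finprod G (\<lambda>k. f k [^] Poly_Mapping.lookup u k) T \<otimes> finprod G (\<lambda>k. f k [^] Poly_Mapping.lookup v k) T"
    using T by (intro finprod_multf) auto
  also have "\<dots> = free_Abelian_lift G f u \<otimes> free_Abelian_lift G f v"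
    using T by (simp add: free_Abelian_lift_superset[of T] T_def)
  finally show "free_Abelian_lift G f (u \<otimes>\<^bsub>free_Abelian_group S\<^esub> v)
      = free_Abelian_lift G f u \<otimes> free_Abelian_lift G f v" by simp
qed

lemma (in comm_group) free_Abelian_lift_of:
  "f k \<in> carrier G \<Longrightarrow> free_Abelian_lift G f (frag_of k) = f k"
  by (simp add: free_Abelian_lift_def finprod_singleton)

text \<open>
  For bilinear \<open>\<beta>\<close> the lift sends each defining relation, hence the subgroup generated by them, to \<open>\<one>\<close>,
  so it is constant on the coset.
\<close>

lemma (in comm_group) tensor_lift_coset:
  fixes M :: "('c, 'p) monoid_scheme" and N :: "('d, 'q) monoid_scheme"
  assumes closed: "\<And>m n. m \<in> carrier M \<Longrightarrow> n \<in> carrier N \<Longrightarrow> \<beta> m n \<in> carrier G"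
    and left: "\<And>m m' n. m \<in> carrier M \<Longrightarrow> m' \<in> carrier M \<Longrightarrow> n \<in> carrier N \<Longrightarrow>
      \<beta> (m \<otimes>\<^bsub>M\<^esub> m') n = \<beta> m n \<otimes> \<beta> m' n"
    and right: "\<And>m n n'. m \<in> carrier M \<Longrightarrow> n \<in> carrier N \<Longrightarrow> n' \<in> carrier N \<Longrightarrow>
      \<beta> m (n \<otimes>\<^bsub>N\<^esub> n') = \<beta> m n \<otimes> \<beta> m n'"
    and M: "group M" and N: "group N"
    and u: "u \<in> carrier (free_Abelian_group (carrier M \<times> carrier N))"
  shows "tensor_lift G \<beta> (generate (free_Abelian_group (carrier M \<times> carrier N)) (tensor_relations M N)
           #>\<^bsub>free_Abelian_group (carrier M \<times> carrier N)\<^esub> u)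
         = free_Abelian_lift G (case_prod \<beta>) u"
proof -
  let ?F = "free_Abelian_group (carrier M \<times> carrier N)"
  let ?l = "free_Abelian_lift G (case_prod \<beta>)"
  interpret M: group M by (rule M)
  interpret N: group N by (rule N)
  interpret F: group ?F by simp
  have hom: "?l \<in> hom ?F G"
    using closed by (intro free_Abelian_lift_hom) auto
  interpret l: group_hom ?F G ?l
    by unfold_locales (rule hom)
  have of: "?l (frag_of (m, n)) = \<beta> m n" if "m \<in> carrier M" "n \<in> carrier N" for m n
    using that closed by (simp add: free_Abelian_lift_of)
  have diff: "?l (c - d) = ?l c \<otimes> inv (?l d)" if "c \<in> carrier ?F" "d \<in> carrier ?F" for c d
    using l.hom_mult[of c "- d"] l.hom_inv[of d] that by simp
  have rel: "?l r = \<one>" if "r \<in> tensor_relations M N" for r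
  proof -
    have *: "x \<otimes> y \<otimes> inv x \<otimes> inv y = \<one>" if "x \<in> carrier G" "y \<in> carrier G" for x y
      using that by (simp add: m_comm[of x y] m_assoc)
    have **: "?l (frag_of p - frag_of q - frag_of s) = ?l (frag_of p) \<otimes> inv (?l (frag_of q)) \<otimes> inv (?l (frag_of s))"
      if "p \<in> carrier M \<times> carrier N" "q \<in> carrier M \<times> carrier N" "s \<in> carrier M \<times> carrier N" for p q s
      using that keys_diff[of "frag_of p" "frag_of q"] by (subst diff; (subst diff)?) auto
    from that show ?thesis
      unfolding tensor_relations_def by (auto simp: ** of left right closed *)
qed
  have keys3: "Poly_Mapping.keys (frag_of p - frag_of q - frag_of s :: 'c \<times> 'd \<Rightarrow>\<^sub>0 int) \<subseteq> {p, q, s}" for p q s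
    using keys_diff[of "frag_of p - frag_of q" "frag_of s"] keys_diff[of "frag_of p" "frag_of q"]
    by auto
  have rel_F: "tensor_relations M N \<subseteq> carrier ?F"
    unfolding tensor_relations_def by (auto dest!: subsetD[OF keys3])
  have "?l g = \<one>" if "g \<in> generate ?F (tensor_relations M N)" for g
  proof -
    have "tensor_relations M N \<subseteq> kernel ?F G ?l"
    proof
      fix r assume r: "r \<in> tensor_relations M N"
      have "r \<in> carrier ?F" using r rel_F by blast
      with rel[OF r] show "r \<in> kernel ?F G ?l" by (simp add: kernel_def)
    qed
    then have "generate ?F (tensor_relations M N) \<subseteq> kernel ?F G ?l"
      by (intro F.generate_subgroup_incl l.subgroup_kernel)
    with that show ?thesis by (auto simp: kernel_def)
  qed
  moreover have "generate ?F (tensor_relations M N) \<subseteq> carrier ?F"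
    by (intro F.generate_incl rel_F)
  ultimately have const: "?l x = ?l u" if "x \<in> generate ?F (tensor_relations M N) #>\<^bsub>?F\<^esub> u" for x
    using that u l.hom_mult l.hom_closed by (auto simp: r_coset_def)
  moreover have "generate ?F (tensor_relations M N) #>\<^bsub>?F\<^esub> u \<noteq> {}"
    using generate.one by (auto simp: r_coset_def)
  ultimately have "?l ` (generate ?F (tensor_relations M N) #>\<^bsub>?F\<^esub> u) = {?l u}"
    by (subst image_cong[OF refl const]) (simp_all add: image_constant_conv)
  then show ?thesis by (simp add: tensor_lift_def)
qed

section \<open>Three-cycles of an abelian group\<close>

text \<open>
  The value on \<open>[x, b, c]\<close> is the shuffle product of \<open>[x]\<close> and \<open>[b|c]\<close>.
\<close>

fun head_shuffle :: "'a list \<Rightarrow> 'a bar_chain" where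
  "head_shuffle [x, b, c] = frag_of [x, b, c] - frag_of [b, x, c] + frag_of [b, c, x]"
| "head_shuffle _ = 0"

lemma frag_extend_mem:
  assumes "0 \<in> N" "\<And>x y. x \<in> N \<Longrightarrow> y \<in> N \<Longrightarrow> x - y \<in> N" "\<And>x. x \<in> Poly_Mapping.keys c \<Longrightarrow> f x \<in> N"
  shows "frag_extend f c \<in> N"
  by (rule frag_induction[of c "Poly_Mapping.keys c" "\<lambda>c. frag_extend f c \<in> N"])
     (use assms in \<open>auto simp: frag_extend_diff\<close>)

text \<open>
  Modulo \<open>N\<close>, boundaries and shuffle products are zero, so \<open>(x, y, z) \<mapsto> [x|y|z]\<close> satisfies the pentagon and
  the hexagon. A free abelian group on the finitely many entries \<open>S\<close> of \<open>z\<close> maps to \<open>G\<close> by \<open>\<epsilon>\<close>; the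
  symmetric cochain \<open>K\<close> on it that bounds the pulled-back cocycle is invariant under the kernel of \<open>\<epsilon>\<close>, so
  it descends along the section \<open>sel\<close> and gives \<open>[a|b|c] \<equiv> \<kappa>(\<partial>[a|b|c])\<close> for \<open>a, b, c \<in> S\<close>.
  Hence \<open>z \<equiv> \<kappa>(\<partial>z) = 0\<close>.
\<close>

theorem (in comm_group) cycle_decomposable:
  assumes z: "z \<in> bar_cycles 3 G"
  obtains y u where "y \<in> bar_chains 4 G" "u \<in> bar_chains 3 G"
    "z = bar_boundary G y + frag_extend head_shuffle u"
proof -
  define N where "N = {bar_boundary G y + frag_extend head_shuffle u | y u.
    y \<in> bar_chains 4 G \<and> u \<in> bar_chains 3 G}"
  have zero: "0 \<in> N"
    unfolding N_def by (intro CollectI exI[of _ 0]) auto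
  have diff: "c - d \<in> N" if "c \<in> N" "d \<in> N" for c d
  proof -
    from that(1) obtain y u where "c = bar_boundary G y + frag_extend head_shuffle u"
      "y \<in> bar_chains 4 G" "u \<in> bar_chains 3 G" unfolding N_def by auto
    moreover from that(2) obtain y' u' where "d = bar_boundary G y' + frag_extend head_shuffle u'"
      "y' \<in> bar_chains 4 G" "u' \<in> bar_chains 3 G" unfolding N_def by auto
    ultimately show ?thesis
      unfolding N_def
      by (intro CollectI exI[of _ "y - y'"] exI[of _ "u - u'"])
         (auto simp: bar_chains_diff bar_boundary_diff frag_extend_diff)
  qed
  interpret N: congruence_subgroup N
    by unfold_locales (use zero diff in auto)
  define S where "S = (\<Union>xs\<in>Poly_Mapping.keys z. set xs)"
  have S: "finite S" "S \<subseteq> carrier G"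
    using z by (auto simp: S_def bar_cycles_def bar_chains_iff bar_simplices_def)
  obtain \<epsilon> where hom: "\<epsilon> \<in> hom (free_Abelian_group UNIV) G"
    and of: "\<And>s. \<epsilon> (frag_of s) = (if s \<in> S then s else \<one>)"
    using free_Abelian_group_universal[of "\<lambda>s. if s \<in> S then s else \<one>" UNIV] S(2) by auto
  interpret \<epsilon>: group_hom "free_Abelian_group UNIV" G \<epsilon>
    using hom by (simp add: group_hom_def group_hom_axioms_def is_group)
  have closed [simp]: "\<epsilon> x \<in> carrier G" for x
    using \<epsilon>.hom_closed[of x] by simp
  have add: "\<epsilon> (x + y) = \<epsilon> x \<otimes> \<epsilon> y" for x y
    using \<epsilon>.hom_mult[of x y] by simp
  have minus: "\<epsilon> (- x) = inv \<epsilon> x" for x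
    using \<epsilon>.hom_inv[of x] by simp
  have sub: "\<epsilon> (x - y) = \<epsilon> x \<otimes> inv \<epsilon> y" for x y
    using add[of x "- y"] minus by simp
  define R where "R = {r. \<epsilon> r = \<one>}"
  define \<psi> where "\<psi> x y z = frag_of [\<epsilon> x, \<epsilon> y, \<epsilon> z]" for x y z
  have cocycle: "strict_symmetric_cocycle N \<psi>"
  proof (unfold_locales, unfold N.cong_def)
    fix x y z w
    have "bar_boundary G (frag_of [\<epsilon> x, \<epsilon> y, \<epsilon> z, \<epsilon> w]) \<in> N"
      unfolding N_def
      by (intro CollectI exI[of _ "frag_of [\<epsilon> x, \<epsilon> y, \<epsilon> z, \<epsilon> w]"] exI[of _ 0])
         (auto simp: bar_simplices_def)
    then show "\<psi> y z w - \<psi> (x + y) z w + \<psi> x (y + z) w - \<psi> x y (z + w) + \<psi> x y z - 0 \<in> N"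
      by (simp add: \<psi>_def add)
  next
    fix x y z
    have "head_shuffle [\<epsilon> x, \<epsilon> y, \<epsilon> z] \<in> N"
      unfolding N_def
      by (intro CollectI exI[of _ 0] exI[of _ "frag_of [\<epsilon> x, \<epsilon> y, \<epsilon> z]"])
         (auto simp: bar_simplices_def)
    then show "\<psi> x y z - \<psi> y x z + \<psi> y z x - 0 \<in> N"
      by (simp add: \<psi>_def)
  qed
  have "\<epsilon> 0 = \<one>" using \<epsilon>.hom_one by simp
  then have "\<exists>K. (\<forall>x y. K x y - K y x \<in> N) \<and> (\<forall>x y z. cobound2 K x y z - \<psi> x y z \<in> N)
     \<and> (\<forall>r\<in>R. \<forall>x y. K (x + r) y - K x y \<in> N)"
    by (intro strict_symmetric_cocycle_cobounds[OF S(1) cocycle]) (auto simp: R_def \<psi>_def add sub of)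
  then obtain K where sym: "\<And>x y. N.cong (K x y) (K y x)"
    and cob: "\<And>x y z. N.cong (cobound2 K x y z) (\<psi> x y z)"
    and per: "\<And>r x y. r \<in> R \<Longrightarrow> N.cong (K (x + r) y) (K x y)"
    unfolding N.cong_def by blast
  define sel where "sel \<alpha> = (SOME x. \<epsilon> x = \<alpha>)" for \<alpha>
  have sel: "\<epsilon> (sel (\<epsilon> x)) = \<epsilon> x" for x
    unfolding sel_def by (rule someI) (rule refl)
  have sel_S: "\<epsilon> (sel s) = s" if "s \<in> S" for s
    using sel[of "frag_of s"] that by (simp add: of)
  have left: "N.cong (K x y) (K x' y)" if "\<epsilon> x = \<epsilon> x'" for x x' y
    using per[of "x - x'" x' y] that by (simp add: R_def sub)
  have right: "N.cong (K y x) (K y x')" if "\<epsilon> x = \<epsilon> x'" for x x' y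
    by (rule N.cong_trans[OF sym N.cong_trans[OF left[OF that] sym]])
  define \<kappa> where "\<kappa> = frag_extend (\<lambda>xs. K (sel (xs ! 0)) (sel (xs ! 1)))"
  have simplex: "frag_of xs - \<kappa> (bar_boundary G (frag_of xs)) \<in> N"
    if xs: "xs \<in> Poly_Mapping.keys z" for xs
  proof -
    have "xs \<in> bar_simplices 3 G"
      using xs z by (auto simp: bar_cycles_def bar_chains_iff)
    then obtain a b c where abc: "xs = [a, b, c]" by (rule bar_simplices_3E)
    have "set xs \<subseteq> S" using xs by (auto simp: S_def)
    then have "a \<in> S" "b \<in> S" "c \<in> S" by (simp_all add: abc)
    note e = sel_S[OF this(1)] sel_S[OF this(2)] sel_S[OF this(3)]
    have ab: "\<epsilon> (sel (a \<otimes> b)) = \<epsilon> (sel a + sel b)" and bc: "\<epsilon> (sel (b \<otimes> c)) = \<epsilon> (sel b + sel c)"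
      using sel[of "sel a + sel b"] sel[of "sel b + sel c"] by (simp_all add: add e)
    have "N.cong (frag_of xs) (\<kappa> (bar_boundary G (frag_of xs)))"
      by (rule N.cong_by[OF N.cong_add[OF N.cong_sym[OF cob[of "sel a" "sel b" "sel c"]]
          N.cong_diff[OF left[OF ab, of "sel c"] right[OF bc, of "sel a"]]]])
         (simp add: abc \<kappa>_def \<psi>_def e cobound2_def frag_extend_add frag_extend_diff)
    then show ?thesis by (simp add: N.cong_def)
  qed
  have "frag_extend (\<lambda>xs. frag_of xs - \<kappa> (bar_boundary G (frag_of xs))) z \<in> N"
    using zero diff simplex by (rule frag_extend_mem)
  also have "frag_extend (\<lambda>xs. frag_of xs - \<kappa> (bar_boundary G (frag_of xs))) z
      = z - \<kappa> (bar_boundary G z)"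
    by (subst bar_boundary_expand[of G z])
       (simp add: frag_extend_pointwise_diff \<kappa>_def frag_extend_frag_extend flip: frag_expansion)
  also have "\<dots> = z"
    using z by (simp add: bar_cycles_def \<kappa>_def)
  finally show ?thesis
    using that unfolding N_def by blast
qed

section \<open>Central subgroups\<close>

text \<open>
  In degree one the class of \<open>[x]\<close> is additive in \<open>x\<close>, so the elements with vanishing class form a
  subgroup; it contains the commutators.
\<close>

lemma (in group) derived_bounds:
  assumes "a \<in> derived G (carrier G)"
  shows "\<exists>s. s \<in> bar_chains 2 G \<and> bar_boundary G s = frag_of [a]"
proof -
  define B where "B = bar_boundary G ` bar_chains 2 G"
  have B_diff: "c - d \<in> B" if "c \<in> B" "d \<in> B" for c d
    using that by (auto simp: B_def bar_chains_diff simp flip: bar_boundary_diff)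
  have B_add: "c + d \<in> B" if "c \<in> B" "d \<in> B" for c d
    using that by (auto simp: B_def bar_chains_add simp flip: bar_boundary_add)
  have mult: "frag_of [x] + frag_of [y] - frag_of [x \<otimes> y] \<in> B"
    if "x \<in> carrier G" "y \<in> carrier G" for x y
    unfolding B_def using that
    by (intro image_eqI[of _ _ "frag_of [x, y]"]) (auto simp: bar_simplices_def)
  have one: "frag_of [\<one>] \<in> B"
    using mult[of \<one> \<one>] by simp
  have inv: "frag_of [x] + frag_of [inv x] \<in> B" if "x \<in> carrier G" for x
    using B_add[OF mult[of x "inv x"] one] that by simp
  define T where "T = {x \<in> carrier G. frag_of [x] \<in> B}"
  have "subgroup T G"
  proof (rule subgroupI)
    fix x assume "x \<in> T"
    then show "inv x \<in> T" using B_diff[OF inv[of x], of "frag_of [x]"] by (simp add: T_def)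
  next
    fix x y assume "x \<in> T" "y \<in> T"
    then show "x \<otimes> y \<in> T"
      using B_diff[OF B_add[of "frag_of [x]" "frag_of [y]"] mult[of x y]] by (simp add: T_def)
  qed (use one in \<open>auto simp: T_def\<close>)
  moreover have "x \<otimes> y \<otimes> inv x \<otimes> inv y \<in> T" if xy: "x \<in> carrier G" "y \<in> carrier G" for x y
  proof -
    \<comment> \<open>Each bracketed difference is the boundary of a 2-simplex.\<close>
    have "frag_of [x \<otimes> y \<otimes> inv x \<otimes> inv y] = (frag_of [x] + frag_of [inv x]) + (frag_of [y] + frag_of [inv y])
      - ((frag_of [x] + frag_of [y] - frag_of [x \<otimes> y])
      + (frag_of [x \<otimes> y] + frag_of [inv x] - frag_of [x \<otimes> y \<otimes> inv x])
      + (frag_of [x \<otimes> y \<otimes> inv x] + frag_of [inv y] - frag_of [x \<otimes> y \<otimes> inv x \<otimes> inv y]))"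
      by (simp add: algebra_simps)
    also have "\<dots> \<in> B"
      using xy by (intro B_add B_diff mult inv) auto
    finally show ?thesis using xy by (simp add: T_def)
  qed
  ultimately have "derived G (carrier G) \<subseteq> T"
    unfolding derived_def by (intro generate_subgroup_incl) auto
  with assms have "frag_of [a] \<in> B" by (auto simp: T_def)
  then show ?thesis by (auto simp: B_def elim!: imageE)
qed

lemma bar_boundary_subgroup [simp]: "bar_boundary (G\<lparr>carrier := A\<rparr>) = bar_boundary G"
proof -
  have eq: "bar_face (G\<lparr>carrier := A\<rparr>) = bar_face G"
    by (intro ext) (simp add: bar_face_def)
  show ?thesis unfolding bar_boundary_def eq ..
qed

lemma bar_chains_subgroup: "A \<subseteq> carrier G \<Longrightarrow> c \<in> bar_chains n (G\<lparr>carrier := A\<rparr>) \<Longrightarrow> c \<in> bar_chains n G"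
  unfolding bar_chains_iff by (auto simp: bar_simplices_def)

lemma bar_map_id: "bar_map (\<lambda>x. x) c = c"
  by (simp add: bar_map_def flip: frag_expansion)

locale central_pair = group G for G :: "('a, 'm) monoid_scheme" (structure) +
  fixes A :: "'a set"
  assumes central: "central_subgroup A G"
begin

abbreviation A_grp where "A_grp \<equiv> G\<lparr>carrier := A\<rparr>"
abbreviation \<rho> where "\<rho> \<equiv> (\<lambda>(a, g). a \<otimes> g)"

text \<open>
  The product of a chain of \<open>A\<close> with a chain of \<open>G\<close> that comes from \<open>\<rho>\<close> being a homomorphism.
\<close>

definition act :: "'a bar_chain \<Rightarrow> 'a bar_chain \<Rightarrow> 'a bar_chain" where
  "act c d = bar_map \<rho> (bar_cross A_grp G c d)"

lemma A_subgroup: "subgroup A G"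
  and A_comm: "\<And>a g. a \<in> A \<Longrightarrow> g \<in> carrier G \<Longrightarrow> a \<otimes> g = g \<otimes> a"
  using central by (auto simp: central_subgroup_def)

lemma A_carrier: "a \<in> A \<Longrightarrow> a \<in> carrier G"
  using A_subgroup by (rule subgroup.mem_carrier)

lemma A_mult: "a \<in> A \<Longrightarrow> b \<in> A \<Longrightarrow> a \<otimes> b \<in> A"
  using A_subgroup by (rule subgroup.m_closed)

lemma group_A_grp: "group A_grp"
  using A_subgroup by (rule subgroup.subgroup_is_group) (rule is_group)

lemma comm_group_A_grp: "comm_group A_grp"
  by (rule group.group_comm_groupI[OF group_A_grp]) (auto simp: A_comm A_carrier)

lemma group_prod: "group (A_grp \<times>\<times> G)"
  by (rule DirProd_group[OF group_A_grp is_group])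

lemma rho_hom: "\<rho> \<in> hom (A_grp \<times>\<times> G) G"
proof (rule homI)
  fix x y assume "x \<in> carrier (A_grp \<times>\<times> G)" "y \<in> carrier (A_grp \<times>\<times> G)"
  then obtain a g b h where x: "x = (a, g)" "y = (b, h)" and "a \<in> A" "g \<in> carrier G" "b \<in> A" "h \<in> carrier G"
    by auto
  then have "a \<otimes> b \<otimes> (g \<otimes> h) = a \<otimes> (b \<otimes> g) \<otimes> h" by (simp add: m_assoc A_carrier)
  also have "b \<otimes> g = g \<otimes> b" using \<open>b \<in> A\<close> \<open>g \<in> carrier G\<close> by (rule A_comm)
  also have "a \<otimes> (g \<otimes> b) \<otimes> h = a \<otimes> g \<otimes> (b \<otimes> h)"
    using \<open>a \<in> A\<close> \<open>g \<in> carrier G\<close> \<open>b \<in> A\<close> \<open>h \<in> carrier G\<close> by (simp add: m_assoc A_carrier)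
  finally show "\<rho> (x \<otimes>\<^bsub>A_grp \<times>\<times> G\<^esub> y) = \<rho> x \<otimes> \<rho> y" by (simp add: x)
qed (auto simp: A_carrier)

lemma act_add_right: "act c (d + d') = act c d + act c d'"
  and act_diff_right: "act c (d - d') = act c d - act c d'"
  and act_add_left: "act (c + c') d = act c d + act c' d"
  and act_diff_left: "act (c - c') d = act c d - act c' d"
  by (simp_all add: act_def bar_cross_add_right bar_cross_diff_right bar_cross_add_left
      bar_cross_diff_left bar_map_add bar_map_diff)

lemma act_chain:
  assumes "c \<in> bar_chains p A_grp" "d \<in> bar_chains q G"
  shows "act c d \<in> bar_chains (p + q) G"
  unfolding act_def using rho_hom
  by (intro bar_map_chain[where G = "A_grp \<times>\<times> G"] bar_cross_chain assms group_A_grp is_group) (auto simp: hom_def)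

lemma act_1_2:
  "x \<in> A \<Longrightarrow> b \<in> carrier G \<Longrightarrow> c \<in> carrier G \<Longrightarrow> act (frag_of [x]) (frag_of [b, c]) = head_shuffle [x, b, c]"
  by (simp add: act_def bar_map_add bar_map_diff bar_map_minus A_carrier
      frag_extend_add frag_extend_diff frag_extend_minus frag_extend_cmul)

lemma act_2_1:
  "x \<in> A \<Longrightarrow> b \<in> A \<Longrightarrow> c \<in> A \<Longrightarrow> act (frag_of [b, c]) (frag_of [x]) = head_shuffle [x, b, c]"
  by (simp add: act_def bar_map_add bar_map_diff bar_map_minus A_carrier
      frag_extend_add frag_extend_diff frag_extend_minus frag_extend_cmul)

lemma act_Leibniz_2:
  assumes "c \<in> bar_chains 2 A_grp" "d \<in> bar_chains 2 G"
  shows "bar_boundary G (act c d) = act (bar_boundary G c) d + act c (bar_boundary G d)"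
  unfolding act_def
  by (subst bar_boundary_map[OF rho_hom bar_cross_chain[OF group_A_grp is_group assms]])
     (simp add: Leibniz_2_2[OF group_A_grp is_group assms] bar_map_add)

text \<open>
  The right-hand side is the antisymmetrisation of the tensor \<open>x \<otimes> \<partial>[b|c]\<close>, up to sign, because
  \<open>[x] \<cdot> [y] = [x|y] - [y|x]\<close>. A sum of such products is a cycle if and only if the corresponding sum of
  tensors is symmetric.
\<close>

lemma head_shuffle_boundary:
  assumes "x \<in> A" "b \<in> A" "c \<in> A"
  shows "bar_boundary G (head_shuffle [x, b, c]) =
    (frag_of [c, x] - frag_of [b \<otimes> c, x] + frag_of [b, x])
    - (frag_of [x, c] - frag_of [x, b \<otimes> c] + frag_of [x, b])"
proof -
  have "x \<otimes> b = b \<otimes> x" "x \<otimes> c = c \<otimes> x"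
    using assms by (simp_all add: A_comm A_carrier)
  then show ?thesis by (simp add: bar_boundary_add bar_boundary_diff)
qed

text \<open>
  Here \<open>\<tau>\<close> is the tensor \<open>x \<otimes> \<partial>[b|c]\<close>, written as a 2-chain, \<open>\<tau>'\<close> is the same tensor with the factors
  exchanged, and \<open>M\<close> is the pairing \<open>p \<otimes> q \<mapsto> [p] \<cdot> s q\<close>. Each of the two copies of \<open>[x] \<cdot> [b|c]\<close> is rewritten in a
  different way: one as \<open>\<partial>([b|c] \<cdot> s x) - M \<tau>'\<close> by the Leibniz rule, the other as \<open>[x] \<cdot> w + M \<tau>\<close> with the
  cycle \<open>w = [b|c] - s(\<partial>[b|c])\<close>. The cycle condition makes \<open>\<tau>\<close> and \<open>\<tau>'\<close> agree after summation.
\<close>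

lemma double_decomposable:
  assumes u: "u \<in> bar_chains 3 A_grp"
    and cycle: "bar_boundary G (frag_extend head_shuffle u) = 0"
    and s: "\<And>a. a \<in> A \<Longrightarrow> s a \<in> bar_chains 2 G" "\<And>a. a \<in> A \<Longrightarrow> bar_boundary G (s a) = frag_of [a]"
  obtains y w where "y \<in> bar_chains 4 G"
    "\<And>xs. xs \<in> bar_simplices 3 A_grp \<Longrightarrow> w xs \<in> bar_cycles 2 G"
    "frag_extend head_shuffle u + frag_extend head_shuffle u
     = bar_boundary G y + frag_extend (\<lambda>xs. act (frag_of [xs ! 0]) (w xs)) u"
proof -
  define \<tau> :: "'a list \<Rightarrow> 'a bar_chain" where
    "\<tau> xs = frag_of [xs ! 0, xs ! 2] - frag_of [xs ! 0, xs ! 1 \<otimes> xs ! 2] + frag_of [xs ! 0, xs ! 1]" for xs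
  define \<tau>' :: "'a list \<Rightarrow> 'a bar_chain" where
    "\<tau>' xs = frag_of [xs ! 2, xs ! 0] - frag_of [xs ! 1 \<otimes> xs ! 2, xs ! 0] + frag_of [xs ! 1, xs ! 0]" for xs
  define M where "M = frag_extend (\<lambda>xs. act (frag_of [xs ! 0]) (s (xs ! 1)))"
  define w where "w xs = frag_of [xs ! 1, xs ! 2] - s (xs ! 2) + s (xs ! 1 \<otimes> xs ! 2) - s (xs ! 1)" for xs
  define Y where "Y xs = act (frag_of [xs ! 1, xs ! 2]) (s (xs ! 0))" for xs
  have "bar_boundary G (frag_extend head_shuffle u) = frag_extend (\<lambda>xs. \<tau>' xs - \<tau> xs) u"
    unfolding bar_boundary_extend
    by (rule frag_extend_chain_cong[OF u])
       (auto elim!: bar_simplices_3E simp: head_shuffle_boundary \<tau>_def \<tau>'_def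
         simp del: head_shuffle.simps)
  with cycle have sym: "frag_extend \<tau>' u = frag_extend \<tau> u"
    by (simp add: frag_extend_pointwise_diff)
  have key: "head_shuffle xs + head_shuffle xs
      = (bar_boundary G (Y xs) + act (frag_of [xs ! 0]) (w xs)) + (M (\<tau> xs) - M (\<tau>' xs))"
    if "xs \<in> bar_simplices 3 A_grp" for xs
    using that
  proof (rule bar_simplices_3E)
    fix x b c assume xs: "xs = [x, b, c]" and "x \<in> carrier A_grp" "b \<in> carrier A_grp" "c \<in> carrier A_grp"
    then have A: "x \<in> A" "b \<in> A" "c \<in> A" by simp_all
    have "frag_of [b, c] \<in> bar_chains 2 A_grp" using A by (simp add: bar_simplices_def)
    from act_Leibniz_2[OF this s(1)[OF A(1)]]
    have "bar_boundary G (Y xs) = M (\<tau>' xs) + head_shuffle xs"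
      using A by (simp add: xs Y_def s(2) act_2_1 M_def \<tau>'_def act_add_left act_diff_left
          frag_extend_add frag_extend_diff)
    moreover have "act (frag_of [xs ! 0]) (w xs) = head_shuffle xs - M (\<tau> xs)"
      using A by (simp add: xs w_def M_def \<tau>_def act_add_right act_diff_right act_1_2 A_carrier
          frag_extend_add frag_extend_diff)
    ultimately show ?thesis by simp
  qed
  show ?thesis
  proof
    show "frag_extend Y u \<in> bar_chains 4 G"
    proof (rule bar_chains_extend[OF u])
      fix xs assume "xs \<in> bar_simplices 3 A_grp"
      then show "Y xs \<in> bar_chains 4 G"
      proof (rule bar_simplices_3E)
        fix x b c assume "xs = [x, b, c]" "x \<in> carrier A_grp" "b \<in> carrier A_grp" "c \<in> carrier A_grp"
        then show ?thesis
          using act_chain[of "frag_of [b, c]" 2 "s x" 2] s(1)[of x] by (simp add: Y_def bar_simplices_def)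
      qed
    qed
    show "w xs \<in> bar_cycles 2 G" if "xs \<in> bar_simplices 3 A_grp" for xs
      using that
    proof (rule bar_simplices_3E)
      fix x b c assume xs: "xs = [x, b, c]" and "x \<in> carrier A_grp" "b \<in> carrier A_grp" "c \<in> carrier A_grp"
      then have A: "x \<in> A" "b \<in> A" "c \<in> A" "b \<otimes> c \<in> A" by (simp_all add: A_mult)
      show ?thesis
      proof (rule bar_cyclesI)
        show "w xs \<in> bar_chains 2 G"
          unfolding w_def xs using A s(1)
          by (auto intro!: bar_chains_diff bar_chains_add simp: bar_simplices_def A_carrier)
        show "bar_boundary G (w xs) = 0"
          using A by (simp add: w_def xs bar_boundary_diff bar_boundary_add s(2))
      qed
    qed
    have "frag_extend head_shuffle u + frag_extend head_shuffle u
        = frag_extend (\<lambda>xs. (bar_boundary G (Y xs) + act (frag_of [xs ! 0]) (w xs)) + (M (\<tau> xs) - M (\<tau>' xs))) u"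
      unfolding frag_extend_pointwise_add[symmetric]
      by (rule frag_extend_chain_cong[OF u key])
    also have "\<dots> = bar_boundary G (frag_extend Y u)
        + frag_extend (\<lambda>xs. act (frag_of [xs ! 0]) (w xs)) u + (M (frag_extend \<tau> u) - M (frag_extend \<tau>' u))"
      by (simp only: frag_extend_pointwise_add frag_extend_pointwise_diff bar_boundary_extend
          M_def frag_extend_frag_extend)
    finally show "frag_extend head_shuffle u + frag_extend head_shuffle u
        = bar_boundary G (frag_extend Y u) + frag_extend (\<lambda>xs. act (frag_of [xs ! 0]) (w xs)) u"
      by (simp add: sym)
  qed
qed

section \<open>The image of the cross product\<close>

definition cross_pairing where
  "cross_pairing = (\<lambda>a z. homology_cross 1 2 A_grp G (homology_class 1 A_grp (frag_of [a])) z)"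

lemma cross_cycle:
  assumes "a \<in> A" "d \<in> bar_cycles 2 G"
  shows "bar_cross A_grp G (frag_of [a]) d \<in> bar_cycles 3 (A_grp \<times>\<times> G)"
proof (rule bar_cyclesI)
  show "bar_cross A_grp G (frag_of [a]) d \<in> bar_chains 3 (A_grp \<times>\<times> G)"
  proof -
    have "bar_cross A_grp G (frag_of [a]) d \<in> bar_chains (1 + 2) (A_grp \<times>\<times> G)"
      using assms by (intro bar_cross_chain group_A_grp is_group) (auto simp: bar_simplices_def bar_cyclesD)
    moreover have "1 + 2 = (3::nat)" by simp
    ultimately show ?thesis by (simp only:)
  qed
  show "bar_boundary (A_grp \<times>\<times> G) (bar_cross A_grp G (frag_of [a]) d) = 0"
    using Leibniz_1[OF group_A_grp is_group, of a d 2] assms by (simp add: bar_cyclesD)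
qed

text \<open>
  This lemma and the next make the cross product independent of the representatives.
\<close>

lemma cross_boundary_left:
  assumes "e \<in> bar_chains 2 A_grp" "d \<in> bar_cycles 2 G"
  shows "bar_cross A_grp G (bar_boundary G e) d \<in> bar_boundaries 3 (A_grp \<times>\<times> G)"
proof (rule bar_boundariesI)
  show "bar_cross A_grp G e d \<in> bar_chains (Suc 3) (A_grp \<times>\<times> G)"
    using bar_cross_chain[OF group_A_grp is_group assms(1) bar_cyclesD(1)[OF assms(2)]] by simp
  show "bar_cross A_grp G (bar_boundary G e) d = bar_boundary (A_grp \<times>\<times> G) (bar_cross A_grp G e d)"
    using Leibniz_2_2[OF group_A_grp is_group assms(1), of d] assms(2) by (simp add: bar_cyclesD)
qed

lemma cross_boundary_right:
  assumes "a \<in> A" "f \<in> bar_boundaries 2 G"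
  shows "bar_cross A_grp G (frag_of [a]) f \<in> bar_boundaries 3 (A_grp \<times>\<times> G)"
proof -
  obtain e where e: "e \<in> bar_chains 3 G" "f = bar_boundary G e"
    using assms(2) by (auto simp: bar_boundaries_def)
  show ?thesis
  proof (rule bar_boundariesI)
    show "- bar_cross A_grp G (frag_of [a]) e \<in> bar_chains (Suc 3) (A_grp \<times>\<times> G)"
      using bar_cross_chain[OF group_A_grp is_group, of "frag_of [a]" 1 e 3] assms(1) e(1)
      by (simp add: bar_simplices_def)
    show "bar_cross A_grp G (frag_of [a]) f = bar_boundary (A_grp \<times>\<times> G) (- bar_cross A_grp G (frag_of [a]) e)"
      using Leibniz_1[OF group_A_grp is_group, of a e 3] assms(1) e by (simp add: bar_boundary_minus)
  qed
qed

lemma cross_pairing_class: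
  assumes "a \<in> A" "d \<in> bar_cycles 2 G"
  shows "cross_pairing a (homology_class 2 G d) = homology_class 3 (A_grp \<times>\<times> G) (bar_cross A_grp G (frag_of [a]) d)"
proof -
  have "homology_class 3 (A_grp \<times>\<times> G) (bar_cross A_grp G c d') = homology_class 3 (A_grp \<times>\<times> G) (bar_cross A_grp G (frag_of [a]) d)"
    if c: "c \<in> homology_class 1 A_grp (frag_of [a])" and d': "d' \<in> homology_class 2 G d" "d' \<in> bar_cycles 2 G" for c d'
  proof -
    obtain e where e: "e \<in> bar_chains 2 A_grp" "c - frag_of [a] = bar_boundary G e"
      using c by (auto simp: homology_class_iff bar_boundaries_def numeral_2_eq_2)
    have "bar_cross A_grp G c d' - bar_cross A_grp G (frag_of [a]) d
        = bar_cross A_grp G (bar_boundary G e) d' + bar_cross A_grp G (frag_of [a]) (d' - d)"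
      by (simp add: bar_cross_diff_left bar_cross_diff_right flip: e(2))
    also have "\<dots> \<in> bar_boundaries 3 (A_grp \<times>\<times> G)"
      using d' assms e(1)
      by (intro bar_boundaries_add cross_boundary_left cross_boundary_right) (auto simp: homology_class_iff)
    finally show ?thesis by (simp add: homology_class_eq)
  qed
  then have const: "homology_class (1 + 2) (A_grp \<times>\<times> G) (bar_cross A_grp G c d')
      = homology_class 3 (A_grp \<times>\<times> G) (bar_cross A_grp G (frag_of [a]) d)"
    if "c \<in> homology_class 1 A_grp (frag_of [a]) \<inter> bar_cycles 1 A_grp"
      "d' \<in> homology_class 2 G d \<inter> bar_cycles 2 G" for c d'
    using that by (simp del: One_nat_def)
  have "frag_of [a] \<in> homology_class 1 A_grp (frag_of [a]) \<inter> bar_cycles 1 A_grp"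
    using assms(1) by (simp add: homology_class_iff bar_cycles_def bar_simplices_def)
  moreover have "d \<in> homology_class 2 G d \<inter> bar_cycles 2 G"
    using assms(2) by (simp add: homology_class_iff)
  ultimately show ?thesis
    unfolding cross_pairing_def homology_cross_def by (intro SUP_eq_const const) auto
qed

lemma cross_pairing_closed:
  assumes "a \<in> A" "z \<in> carrier (group_homology 2 G)"
  shows "cross_pairing a z \<in> carrier (group_homology 3 (A_grp \<times>\<times> G))"
  using assms by (auto simp: carrier_group_homology cross_pairing_class cross_cycle)

text \<open>
  Additivity in \<open>a\<close> holds only on homology: \<open>[a] + [b] - [a b]\<close> is the boundary of \<open>[a|b]\<close>.
\<close>

lemma cross_pairing_left:
  assumes "a \<in> A" "b \<in> A" "z \<in> carrier (group_homology 2 G)"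
  shows "cross_pairing (a \<otimes> b) z = cross_pairing a z \<otimes>\<^bsub>group_homology 3 (A_grp \<times>\<times> G)\<^esub> cross_pairing b z"
proof -
  obtain d where d: "z = homology_class 2 G d" "d \<in> bar_cycles 2 G"
    using assms(3) by (auto simp: carrier_group_homology)
  have "bar_cross A_grp G (bar_boundary G (- frag_of [a, b])) d \<in> bar_boundaries 3 (A_grp \<times>\<times> G)"
    using assms d by (intro cross_boundary_left) (auto simp: bar_simplices_def)
  then have "bar_cross A_grp G (frag_of [a \<otimes> b]) d
      - (bar_cross A_grp G (frag_of [a]) d + bar_cross A_grp G (frag_of [b]) d) \<in> bar_boundaries 3 (A_grp \<times>\<times> G)"
    by (simp add: bar_boundary_minus bar_cross_add_left bar_cross_diff_left bar_cross_minus_left algebra_simps)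
  then show ?thesis
    using assms d
    by (simp add: cross_pairing_class A_mult group.homology_class_mult[OF group_prod] cross_cycle homology_class_eq)
qed

lemma cross_pairing_right:
  assumes "a \<in> A" "z \<in> carrier (group_homology 2 G)" "z' \<in> carrier (group_homology 2 G)"
  shows "cross_pairing a (z \<otimes>\<^bsub>group_homology 2 G\<^esub> z') = cross_pairing a z \<otimes>\<^bsub>group_homology 3 (A_grp \<times>\<times> G)\<^esub> cross_pairing a z'"
proof -
  obtain d d' where d: "z = homology_class 2 G d" "d \<in> bar_cycles 2 G"
    "z' = homology_class 2 G d'" "d' \<in> bar_cycles 2 G"
    using assms by (auto simp: carrier_group_homology)
  then show ?thesis
    using assms(1)
    by (simp add: cross_pairing_class homology_class_mult group.homology_class_mult[OF group_prod] cross_cycle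
        bar_cycles_add bar_cross_add_right)
qed

text \<open>
  The cross product pairing is bilinear, so the map on the tensor product may be evaluated on
  representatives in the free abelian group; this shows the image as that of a homomorphism.
\<close>

lemma rho_image_eq:
  "rho_image G A = (\<lambda>u. group_homology_map 3 (A_grp \<times>\<times> G) G \<rho>
      (free_Abelian_lift (group_homology 3 (A_grp \<times>\<times> G)) (case_prod cross_pairing) u))
    ` carrier (free_Abelian_group (A \<times> carrier (group_homology 2 G)))"
proof -
  interpret P: comm_group "group_homology 3 (A_grp \<times>\<times> G)"
    by (rule group.comm_group_homology[OF group_prod]) simp
  have H2: "group (group_homology 2 G)"
    using comm_group_homology[of 2] by (simp add: comm_group.axioms)
  have "tensor_cross_map G A (generate (free_Abelian_group (A \<times> carrier (group_homology 2 G)))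
        (tensor_relations A_grp (group_homology 2 G)) #>\<^bsub>free_Abelian_group (A \<times> carrier (group_homology 2 G))\<^esub> u)
      = free_Abelian_lift (group_homology 3 (A_grp \<times>\<times> G)) (case_prod cross_pairing) u"
    if "u \<in> carrier (free_Abelian_group (A \<times> carrier (group_homology 2 G)))" for u
    unfolding tensor_cross_map_def cross_pairing_def[symmetric]
    using P.tensor_lift_coset[of A_grp "group_homology 2 G" cross_pairing u] that cross_pairing_closed cross_pairing_left cross_pairing_right group_A_grp H2
    by simp
  then show ?thesis
    unfolding rho_image_def tensor_product_def Let_def carrier_FactGroup image_image
    by (intro image_cong) auto
qed

lemma rho_image_subgroup: "subgroup (rho_image G A) (group_homology 3 G)"
  and act_in_rho_image: "a \<in> A \<Longrightarrow> w \<in> bar_cycles 2 G \<Longrightarrow>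
    homology_class 3 G (act (frag_of [a]) w) \<in> rho_image G A"
proof -
  interpret P: comm_group "group_homology 3 (A_grp \<times>\<times> G)"
    by (rule group.comm_group_homology[OF group_prod]) simp
  interpret Q: comm_group "group_homology 3 G"
    by (rule comm_group_homology) simp
  let ?F = "free_Abelian_group (A \<times> carrier (group_homology 2 G))"
  let ?l = "free_Abelian_lift (group_homology 3 (A_grp \<times>\<times> G)) (case_prod cross_pairing)"
  let ?r = "group_homology_map 3 (A_grp \<times>\<times> G) G \<rho>"
  have "?l \<in> hom ?F (group_homology 3 (A_grp \<times>\<times> G))"
    using cross_pairing_closed by (intro P.free_Abelian_lift_hom) auto
  moreover have "?r \<in> hom (group_homology 3 (A_grp \<times>\<times> G)) (group_homology 3 G)"
    by (rule group_homology_map_hom[OF group_prod is_group rho_hom]) simp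
  ultimately have "?r \<circ> ?l \<in> hom ?F (group_homology 3 G)"
    by (rule Group.hom_compose)
  then interpret h: group_hom ?F "group_homology 3 G" "?r \<circ> ?l"
    by (simp add: group_hom_def group_hom_axioms_def Q.is_group)
  have eq: "rho_image G A = (?r \<circ> ?l) ` carrier ?F"
    by (simp add: rho_image_eq image_image)
  show "subgroup (rho_image G A) (group_homology 3 G)"
    unfolding eq by (rule h.img_is_subgroup)
  show "homology_class 3 G (act (frag_of [a]) w) \<in> rho_image G A" if "a \<in> A" "w \<in> bar_cycles 2 G"
  proof -
    have z: "homology_class 2 G w \<in> carrier (group_homology 2 G)"
      using that by (simp add: carrier_group_homology)
    have "?l (frag_of (a, homology_class 2 G w)) = cross_pairing a (homology_class 2 G w)"
      using cross_pairing_closed[OF that(1) z] by (simp add: P.free_Abelian_lift_of)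
    then have "(?r \<circ> ?l) (frag_of (a, homology_class 2 G w)) = homology_class 3 G (act (frag_of [a]) w)"
      using that
      by (simp add: cross_pairing_class act_def group_homology_map_class[OF group_prod is_group rho_hom] cross_cycle)
    moreover have "frag_of (a, homology_class 2 G w) \<in> carrier ?F"
      using that z by simp
    ultimately show ?thesis unfolding eq by (metis imageI)
  qed
qed

text \<open>
  The two parts of the argument put together: \<open>z\<close> is decomposed in \<open>A\<close>, and twice the decomposable
  part is a sum of products \<open>[x] \<cdot> w\<close> with 2-cycles \<open>w\<close> of \<open>G\<close>, up to boundaries.
\<close>

lemma double_in_rho_image:
  assumes derived: "A \<subseteq> derived G (carrier G)" and z: "z \<in> bar_cycles 3 A_grp"
  shows "homology_class 3 G (z + z) \<in> rho_image G A"
proof -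
  interpret Q: comm_group "group_homology 3 G"
    by (rule comm_group_homology) simp
  interpret I: subgroup "rho_image G A" "group_homology 3 G"
    by (rule rho_image_subgroup)
  have "\<exists>s. \<forall>a\<in>A. s a \<in> bar_chains 2 G \<and> bar_boundary G (s a) = frag_of [a]"
    using derived derived_bounds by (intro bchoice) blast
  then obtain s where s: "\<And>a. a \<in> A \<Longrightarrow> s a \<in> bar_chains 2 G"
    "\<And>a. a \<in> A \<Longrightarrow> bar_boundary G (s a) = frag_of [a]" by blast
  obtain y u where y: "y \<in> bar_chains 4 A_grp" and u: "u \<in> bar_chains 3 A_grp"
    and zyu: "z = bar_boundary G y + frag_extend head_shuffle u"
    using comm_group.cycle_decomposable[OF comm_group_A_grp z] by auto
  have A_sub: "A \<subseteq> carrier G" using A_carrier by blast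
  have yG: "y \<in> bar_chains 4 G" using y by (rule bar_chains_subgroup[OF A_sub])
  have "bar_boundary G z = 0" using bar_cyclesD(2)[OF z] by simp
  then have "bar_boundary G (frag_extend head_shuffle u) = 0"
    using bar_boundary_boundary[OF yG] by (simp add: zyu bar_boundary_add)
  from double_decomposable[OF u this s]
  obtain y' w where y': "y' \<in> bar_chains 4 G"
    and w: "\<And>xs. xs \<in> bar_simplices 3 A_grp \<Longrightarrow> w xs \<in> bar_cycles 2 G"
    and dbl: "frag_extend head_shuffle u + frag_extend head_shuffle u
     = bar_boundary G y' + frag_extend (\<lambda>xs. act (frag_of [xs ! 0]) (w xs)) u"
    by blast
  let ?v = "frag_extend (\<lambda>xs. act (frag_of [xs ! 0]) (w xs)) u"
  have "z + z - ?v = bar_boundary G (y + y + y')"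
    using dbl by (simp add: zyu bar_boundary_add algebra_simps)
  then have "z + z - ?v \<in> bar_boundaries 3 G"
    using yG y' by (intro bar_boundariesI[of "y + y + y'"]) (auto intro!: bar_chains_add)
  then have "homology_class 3 G (z + z) = homology_class 3 G ?v"
    by (simp add: homology_class_eq)
  also have "\<dots> \<in> rho_image G A"
  proof -
    define J where "J = {c \<in> bar_cycles 3 G. homology_class 3 G c \<in> rho_image G A}"
    have zero: "0 \<in> J" using I.one_closed by (simp add: J_def homology_class_0)
    have diff: "c - d \<in> J" if "c \<in> J" "d \<in> J" for c d
    proof -
      have cyc: "c \<in> bar_cycles 3 G" "d \<in> bar_cycles 3 G" "c - d \<in> bar_cycles 3 G"
        using that by (auto simp: J_def bar_cycles_diff)
      have "homology_class 3 G (c - d) \<otimes>\<^bsub>group_homology 3 G\<^esub> homology_class 3 G d = homology_class 3 G c"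
        using cyc by (simp add: homology_class_mult)
      moreover have "homology_class 3 G x \<in> carrier (group_homology 3 G)" if "x \<in> bar_cycles 3 G" for x
        using that by (simp add: carrier_group_homology)
      ultimately have "homology_class 3 G (c - d) = homology_class 3 G c \<otimes>\<^bsub>group_homology 3 G\<^esub>
          inv\<^bsub>group_homology 3 G\<^esub> homology_class 3 G d"
        using cyc by (metis Q.inv_solve_right)
      then show ?thesis using that cyc by (simp add: J_def I.m_closed I.m_inv_closed)
    qed
    have "?v \<in> J"
    proof (rule frag_extend_mem[OF zero diff])
      fix xs assume "xs \<in> Poly_Mapping.keys u"
      then have xs: "xs \<in> bar_simplices 3 A_grp" using u by (auto simp: bar_chains_iff)
      then have "xs ! 0 \<in> A" by (auto elim!: bar_simplices_3E)
      have "bar_map \<rho> (bar_cross A_grp G (frag_of [xs ! 0]) (w xs)) \<in> bar_cycles 3 G"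
        by (rule bar_map_cycle[OF rho_hom cross_cycle[OF \<open>xs ! 0 \<in> A\<close> w[OF xs]]])
      then show "act (frag_of [xs ! 0]) (w xs) \<in> J"
        using act_in_rho_image[OF \<open>xs ! 0 \<in> A\<close> w[OF xs]] by (simp add: J_def act_def)
    qed
    then show ?thesis by (simp add: J_def)
  qed
  finally show ?thesis .
qed

end

theorem theorem3p2:
  fixes G :: "('a, 'm) monoid_scheme" and A :: "'a set"
  assumes "group G"
    and "central_subgroup A G"
    and "A \<subseteq> derived G (carrier G)"
  shows "two_torsion ((rho_quotient G A)\<lparr>carrier :=
           natural_map G A ` carrier (group_homology 3 (G\<lparr>carrier := A\<rparr>))\<rparr>)"
proof -
  interpret group G by fact
  interpret central_pair G A by unfold_locales fact
  interpret Q: comm_group "group_homology 3 G"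
    by (rule comm_group_homology) simp
  interpret I: normal "rho_image G A" "group_homology 3 G"
    using rho_image_subgroup by (simp add: Q.normal_iff_subgroup)
  interpret T: comm_group "rho_quotient G A"
    unfolding rho_quotient_def by (rule Q.abelian_FactGroup[OF rho_image_subgroup])
  have H3A: "group (group_homology 3 A_grp)"
    using group.comm_group_homology[OF group_A_grp, of 3] by (simp add: comm_group.axioms)
  have incl: "(\<lambda>a. a) \<in> hom A_grp G"
    by (auto simp: hom_def A_carrier)
  have "(\<lambda>X. rho_image G A #>\<^bsub>group_homology 3 G\<^esub> X) \<circ> group_homology_map 3 A_grp G (\<lambda>a. a)
      \<in> hom (group_homology 3 A_grp) (rho_quotient G A)"
    unfolding rho_quotient_def
    using group_homology_map_hom[OF group_A_grp is_group incl, of 3] I.r_coset_hom_Mod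
    by (intro Group.hom_compose) auto
  then have "natural_map G A \<in> hom (group_homology 3 A_grp) (rho_quotient G A)"
    by (simp add: natural_map_def [abs_def] comp_def)
  then interpret n: group_hom "group_homology 3 A_grp" "rho_quotient G A" "natural_map G A"
    by (simp add: group_hom_def group_hom_axioms_def H3A T.is_group)
  have sub: "subgroup (natural_map G A ` carrier (group_homology 3 A_grp)) (rho_quotient G A)"
    by (rule n.img_is_subgroup)
  let ?K = "(rho_quotient G A)\<lparr>carrier := natural_map G A ` carrier (group_homology 3 A_grp)\<rparr>"
  have K: "group ?K"
    by (rule subgroup.subgroup_is_group[OF sub T.is_group])
  have "comm_group ?K"
    using T.m_comm n.hom_closed by (intro group.group_comm_groupI[OF K]) auto
  moreover have "x [^]\<^bsub>?K\<^esub> (2::nat) = \<one>\<^bsub>?K\<^esub>" if x: "x \<in> carrier ?K" for x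
  proof -
    obtain z where z: "z \<in> bar_cycles 3 A_grp" "x = natural_map G A (homology_class 3 A_grp z)"
      using x by (auto simp: carrier_group_homology)
    have xT: "x \<in> carrier (rho_quotient G A)" using x n.hom_closed by auto
    have zz: "z + z \<in> bar_cycles 3 A_grp" using z(1) by (intro bar_cycles_add)
    have "x [^]\<^bsub>?K\<^esub> (2::nat) = x \<otimes>\<^bsub>rho_quotient G A\<^esub> x"
      using xT by (simp add: numeral_2_eq_2)
    also have "\<dots> = natural_map G A (homology_class 3 A_grp (z + z))"
      using z by (simp add: group.homology_class_mult[OF group_A_grp] carrier_group_homology flip: n.hom_mult)
    also have "\<dots> = rho_image G A #>\<^bsub>group_homology 3 G\<^esub> homology_class 3 G (z + z)"
      using zz by (simp add: natural_map_def group_homology_map_class[OF group_A_grp is_group incl] bar_map_id)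
    also have "\<dots> = rho_image G A"
      using double_in_rho_image[OF assms(3) z(1)] rho_image_subgroup
      by (intro Q.coset_join2) (auto intro: I.mem_carrier)
    finally show ?thesis by (simp add: rho_quotient_def)
  qed
  ultimately show ?thesis by (simp add: two_torsion_def)
qed

end
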